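(* Let $c$ be a constant with $c<100\log 2-2$. For every $\varepsilon>0$ there exists an integer $n_0$ with the following property. Let $t$ be a positive integer, let $A$ be a nonempty finite multiset of integers and let $\mathrm{diam}(A)=\max(A)-\min(A)$. Assume that $\mathrm{diam}(A)\ge n_0$ and that $\sum_{a\in A}w_A(a)\le(\mathrm{diam}(A)+1)^{c}$. If $B$ is a multiset of integers such that $A\oplus_t B=\mathbb{Z}$, then $B$ is periodic with a period $k$ satisfying \[\log k\le(\mathrm{diam}(A)+1)^{\frac13+\varepsilon}.\]
   Context: A multiset $S$ of integers is described by its weight function $w_S:\mathbb{Z}\to\mathbb{Z}_{\ge 0}$ ($w_S(n)$ = number of occurrences of $n$ in $S$); its elements are the integers of positive weight. For a finite multiset $A$ and a multiset $B$, $R_{A,B}(n)=\sum_{n=a+b,\ a\in A,\ b\in B} w_A(a)w_B(b)$. $A\oplus_t B=\mathbb{Z}$ means $A+B=\{a+b:a\in A,b\in B\}=\mathbb{Z}$ and $R_{A,B}(n)=t$ for all $n\in\mathbb{Z}$. $B$ is periodic with period $k\in\mathbb{Z}_{>0}$ if $w_B(n+k)=w_B(n)$ for all $n\in\mathbb{Z}$. $\log$ is the natural logarithm. *)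

theory Defs
  imports Complex_Main "HOL-Library.Multiset"
begin

text \<open>
  The multiset \<open>A\<close> is finite and is a library multiset, with weight function \<^term>\<open>count A\<close>.
  The multiset \<open>B\<close> has infinitely many elements in general, so it is given by its weight
  function \<open>B :: int \<Rightarrow> nat\<close>.
\<close>

definition elements :: "(int \<Rightarrow> nat) \<Rightarrow> int set" where
  "elements B = {b. B b > 0}"

text \<open>
  The index set below is finite because \<open>A\<close> is finite and \<open>b\<close> is determined by \<open>a\<close>;
  hence the sum is never the default value of a sum over an infinite set.
\<close>

definition rep_count :: "int multiset \<Rightarrow> (int \<Rightarrow> nat) \<Rightarrow> int \<Rightarrow> nat" where
  "rep_count A B n =
     (\<Sum>(a, b)\<in>{(a, b). a \<in># A \<and> b \<in> elements B \<and> n = a + b}. count A a * B b)"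

definition is_tiling :: "nat \<Rightarrow> int multiset \<Rightarrow> (int \<Rightarrow> nat) \<Rightarrow> bool" where
  "is_tiling t A B \<longleftrightarrow>
     {a + b | a b. a \<in># A \<and> b \<in> elements B} = UNIV \<and> (\<forall>n. rep_count A B n = t)"

definition periodic_with :: "(int \<Rightarrow> nat) \<Rightarrow> int \<Rightarrow> bool" where
  "periodic_with B k \<longleftrightarrow> k > 0 \<and> (\<forall>n. B (n + k) = B n)"

text \<open>The diameter is used for nonempty \<open>A\<close> only.\<close>

definition diam :: "int multiset \<Rightarrow> int" where
  "diam A = Max (set_mset A) - Min (set_mset A)"

end

theory Submission
  imports Defs "HOL-Computational_Algebra.Computational_Algebra" "HOL-Number_Theory.Totient"
    "HOL-Real_Asymp.Real_Asymp"
begin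

text \<open>
  Let \<open>x = diam A + 1\<close> and let \<open>P\<close> be the mask polynomial of \<open>A\<close>. By discrete Fourier analysis \<open>B\<close> is
  periodic with period the least common multiple of a set \<open>D\<close> of integers \<open>d\<close> such that the
  cyclotomic polynomial \<open>\<Phi>\<^sub>d\<close> divides \<open>P\<close>; in particular the totients of the \<open>d \<in> D\<close> sum up to
  at most \<open>x\<close>. As every prime power dividing some \<open>d \<in> D\<close> is at most \<open>2 x\<close>, it is enough to count
  the primes \<open>p\<close> dividing this least common multiple. Choose \<open>d = m p\<^sup>a \<in> D\<close> with \<open>p\<close> not dividing \<open>m\<close> and \<open>a\<close> maximal.

  If \<open>m > x\<^sup>1\<^sup>/\<^sup>3\<close>, then \<open>d\<close> is large compared with \<open>p\<close>, and the bound for the sum of the totients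
  shows that there are few such \<open>p\<close>.

  If \<open>m \<le> x\<^sup>1\<^sup>/\<^sup>3\<close>, consider the first nonvanishing derivative of \<open>P\<close> at the primitive \<open>m\<close>-th roots of
  unity, of order \<open>\<mu> m\<close>, the multiplicity of \<open>\<Phi>\<^sub>m\<close> in \<open>P\<close>. Modulo \<open>\<Phi>\<^sub>m\<close>, the polynomial \<open>\<Phi>\<close> of index
  \<open>m p\<^sup>a\<close> is divisible by \<open>p\<close>, so taking norms bounds the product of all such \<open>p\<close> by a power of \<open>x\<close>
  with exponent \<open>c + \<mu> m\<close>. The same inequality for a single prime shows that \<open>c + \<mu> m\<close>
  grows at most by a factor of order \<open>ln x\<close> for each prime factor of \<open>m\<close>, and the sum of
  \<open>(ln x)\<close> to the number of prime factors of \<open>m\<close>, over \<open>m \<le> x\<^sup>1\<^sup>/\<^sup>3\<close>, exceeds \<open>x\<^sup>1\<^sup>/\<^sup>3\<close> only by a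
  subpolynomial factor.
\<close>

section \<open>Integer polynomials at complex points\<close>

text \<open>Polynomials stay over the integers, so that divisibility and congruences live in Z[X];
  only their values are complex.\<close>

definition ev :: "int poly \<Rightarrow> complex \<Rightarrow> complex" where
  "ev P z = poly (map_poly of_int P) z"

lemma ev_0 [simp]: "ev 0 z = 0"
  by (simp add: ev_def)

lemma ev_pCons [simp]: "ev (pCons a P) z = of_int a + z * ev P z"
  by (simp add: ev_def map_poly_pCons)

lemma ev_1 [simp]: "ev 1 z = 1"
  unfolding one_pCons by simp

lemma ev_add [simp]: "ev (P + Q) z = ev P z + ev Q z"
  by (induction P Q rule: poly_induct2) (simp_all add: algebra_simps)

lemma ev_uminus [simp]: "ev (- P) z = - ev P z"
  by (induction P) (simp_all add: algebra_simps)

lemma ev_diff [simp]: "ev (P - Q) z = ev P z - ev Q z"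
  using ev_add[of P "- Q" z] by simp

lemma ev_smult [simp]: "ev (smult a P) z = of_int a * ev P z"
  by (induction P) (simp_all add: algebra_simps)

lemma ev_mult [simp]: "ev (P * Q) z = ev P z * ev Q z"
  by (induction P) (simp_all add: algebra_simps)

lemma ev_power [simp]: "ev (P ^ k) z = ev P z ^ k"
  by (induction k) simp_all

lemma ev_prod: "ev (\<Prod>i\<in>I. f i) z = (\<Prod>i\<in>I. ev (f i) z)"
  by (induction I rule: infinite_finite_induct) simp_all

lemma ev_monom [simp]: "ev (monom a k) z = of_int a * z ^ k"
  by (simp add: ev_def map_poly_monom poly_monom)

lemma ev_pcompose [simp]: "ev (pcompose P Q) z = ev P (ev Q z)"
  by (induction P) (simp_all add: pcompose_pCons)

lemma ev_altdef: "ev P z = (\<Sum>i\<le>degree P. of_int (coeff P i) * z ^ i)"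
  by (simp add: ev_def poly_altdef degree_map_poly coeff_map_poly)

lemma card_ev_roots:
  assumes "P \<noteq> 0"
  shows "finite {z. ev P z = 0}" "card {z. ev P z = 0} \<le> degree P"
proof -
  have *: "(map_poly of_int P :: complex poly) \<noteq> 0"
    using assms by (simp add: map_poly_eq_0_iff)
  show "finite {z. ev P z = 0}"
    unfolding ev_def using poly_roots_finite[OF *] by simp
  show "card {z. ev P z = 0} \<le> degree P"
    unfolding ev_def using card_poly_roots_bound[OF *] by (simp add: degree_map_poly)
qed

section \<open>Minimal polynomials of roots of unity over the integers\<close>

lemma monic_division:
  fixes g P :: "int poly"
  assumes "lead_coeff g = 1"
  obtains q r where "P = g * q + r" "r = 0 \<or> degree r < degree g"
proof -
  obtain q r where qr: "pseudo_divmod P g = (q, r)" by force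
  have "g \<noteq> 0" using assms by auto
  \<comment> \<open>Pseudo-division scales \<open>P\<close> by a power of the leading coefficient of
    \<open>g\<close>, which is 1.\<close>
  from pseudo_divmod[OF this qr] assms that show ?thesis by simp
qed


lemma monom_minus_one:
  assumes "d > 0"
  shows "lead_coeff (monom 1 d - 1 :: int poly) = 1" "degree (monom 1 d - 1 :: int poly) = d"
proof -
  have "degree (monom 1 d - 1 :: int poly) = degree (monom 1 d + (- 1) :: int poly)" by simp
  also have "\<dots> = d" using assms by (subst degree_add_eq_left) (simp_all add: degree_monom_eq)
  finally show *: "degree (monom 1 d - 1 :: int poly) = d" .
  show "lead_coeff (monom 1 d - 1 :: int poly) = 1"
    unfolding * using assms by (simp add: coeff_1)
qed

text \<open>Gauss's lemma: take the primitive part of a nonzero polynomial of least degree vanishing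
  at \<open>z\<close>. By pseudo-division it divides every other such polynomial up to an integer
  factor, which primitive parts remove. As it divides X^d - 1, its leading coefficient is 1 or
  -1.\<close>

lemma ex_minimal_polynomial:
  fixes z :: complex
  assumes "d > 0" "z ^ d = 1"
  shows "\<exists>g. lead_coeff g = 1 \<and> ev g z = 0 \<and> (\<forall>P. ev P z = 0 \<longrightarrow> g dvd P)"
proof -
  define X :: "int poly" where "X = monom 1 d - 1"
  have lX: "lead_coeff X = 1"
    unfolding X_def by (rule monom_minus_one) fact
  have evX: "ev X z = 0" by (simp add: X_def assms)
  from lX have X0: "X \<noteq> 0" by auto
  define Q where "Q = (\<lambda>P. P \<noteq> 0 \<and> ev P z = 0)"
  have "Q X" using X0 evX by (simp add: Q_def)
  then obtain g0 where g0: "Q g0" and min: "\<And>P. Q P \<Longrightarrow> degree g0 \<le> degree P"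
    by (metis ex_has_least_nat)
  define g where "g = primitive_part g0"
  have g0_eq: "g0 = smult (content g0) g" by (simp add: g_def)
  have c0: "content g0 \<noteq> 0" using g0 by (simp add: Q_def)
  have evg: "ev g z = 0"
    using g0 c0 arg_cong[OF g0_eq, of "\<lambda>P. ev P z"] unfolding Q_def ev_smult by auto
  have gnz: "g \<noteq> 0" using g0 by (simp add: Q_def g_def)
  have gdeg: "degree g = degree g0" by (simp add: g_def)
  have gprim: "primitive_part g = g" using g0
    by (intro primitive_part_prim) (simp add: g_def Q_def)
  have dvd: "g dvd P" if "ev P z = 0" for P
  proof -
    define r where "r = pseudo_mod P g"
    obtain a q where a: "a \<noteq> 0" "smult a P = g * q + r"
      using pseudo_mod(1)[OF gnz, of P] unfolding r_def by blast
    have r: "r = 0 \<or> degree r < degree g"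
      using pseudo_mod(2)[OF gnz, of P] unfolding r_def by blast
    have "ev r z = 0"
      using arg_cong[OF a(2), of "\<lambda>P. ev P z"] that evg by simp
    with min[of r] r have "r = 0" unfolding gdeg Q_def by fastforce
    with a have "g dvd smult a P" by simp
    then have "g dvd primitive_part (smult a P)"
      using primitive_part_dvd_primitive_partI gprim by metis
    then have "g dvd smult (unit_factor a) (primitive_part P)"
      by (simp add: primitive_part_smult)
    moreover have "unit_factor a = 1 \<or> unit_factor a = - 1"
      using a by (simp add: sgn_if)
    ultimately have "g dvd primitive_part P" by auto
    then have "g dvd smult (content P) (primitive_part P)" by (rule dvd_smult)
    then show ?thesis by simp
  qed
  have "lead_coeff g dvd lead_coeff X"
    using dvd[OF evX] by (auto simp: lead_coeff_mult elim!: dvdE)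
  then have "lead_coeff g = 1 \<or> lead_coeff g = - 1"
    using lX by auto
  then show ?thesis
  proof
    assume "lead_coeff g = 1"
    with evg dvd show ?thesis by blast
  next
    assume "lead_coeff g = - 1"
    then have "lead_coeff (- g) = 1" by simp
    moreover have "ev (- g) z = 0" using evg by simp
    ultimately show ?thesis using dvd by (metis minus_dvd_iff)
  qed
qed

section \<open>Frobenius congruences and conjugate roots of unity\<close>

lemma add_power_prime_cong:
  fixes a b :: "'a :: comm_ring_1"
  assumes "prime q"
  shows "of_nat q dvd (a + b) ^ q - a ^ q - b ^ q"
proof -
  define S where "S = (\<Sum>k\<in>{1..<q}. of_nat (q choose k) * a ^ k * b ^ (q - k))"
  have q: "q \<ge> 2" using assms by (rule prime_ge_2_nat)
  have "(a + b) ^ q = (\<Sum>k\<le>q. of_nat (q choose k) * a ^ k * b ^ (q - k))"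
    by (rule binomial_ring)
  also have "{..q} = insert 0 (insert q {1..<q})" using q by auto
  also have "(\<Sum>k\<in>\<dots>. of_nat (q choose k) * a ^ k * b ^ (q - k)) = b ^ q + (a ^ q + S)"
    using q by (simp add: S_def)
  finally have *: "(a + b) ^ q - a ^ q - b ^ q = S" by simp
  have "of_nat q dvd of_nat (q choose k) * a ^ k * b ^ (q - k)" if "k \<in> {1..<q}" for k
  proof -
    have "q dvd q choose k" using assms that by (intro dvd_choose_prime) auto
    then have "(of_nat q :: 'a) dvd of_nat (q choose k)" by (auto elim!: dvdE)
    then show ?thesis by simp
  qed
  then have "of_nat q dvd S" unfolding S_def by (intro dvd_sum) auto
  with * show ?thesis by simp
qed

lemma int_power_prime_cong:
  fixes a :: int
  assumes "prime q"
  shows "int q dvd a ^ q - a"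
proof (induction a rule: int_induct[where k = 0])
  case base
  show ?case using prime_gt_0_nat[OF assms] by (simp add: power_0_left)
next
  case (step1 a)
  have "int q dvd ((a + 1) ^ q - a ^ q - 1 ^ q) + (a ^ q - a)"
    using add_power_prime_cong[OF assms, of a 1] step1 by (intro dvd_add) auto
  then show ?case by (simp add: algebra_simps)
next
  case (step2 a)
  have *: "int q dvd (a - 1 + 1) ^ q - (a - 1) ^ q - 1 ^ q"
    using add_power_prime_cong[OF assms, of "a - 1" 1] by simp
  show ?case using dvd_diff[OF step2(2) *] by (simp add: algebra_simps)
qed

text \<open>Induction along \<open>pCons\<close>: modulo \<open>q\<close> the \<open>q\<close>-th
  power is additive, and Fermat's little theorem handles the constant coefficient.\<close>

lemma pcompose_monom_prime_cong:
  fixes P :: "int poly"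
  assumes "prime q"
  shows "[:int q:] dvd pcompose P (monom 1 q) - P ^ q"
proof (induction P)
  case 0
  then show ?case using prime_gt_0_nat[OF assms] by (simp add: power_0_left)
next
  case (pCons a P)
  have X: "pCons a P = [:a:] + monom 1 1 * P" by (simp add: monom_altdef)
  have "[:int q:] dvd (pCons a P) ^ q - [:a:] ^ q - (monom 1 1 * P) ^ q"
    using add_power_prime_cong[OF assms, of "[:a:]" "monom 1 1 * P"] by (simp only: X of_nat_poly)
  moreover have "[:int q:] dvd [:a:] ^ q - [:a:]"
    using int_power_prime_cong[OF assms, of a] by (simp add: poly_const_pow const_poly_dvd_const_poly_iff)
  moreover have "[:int q:] dvd monom 1 q * (pcompose P (monom 1 q) - P ^ q)"
    using pCons(2) by (rule dvd_mult)
  ultimately have "[:int q:] dvd monom 1 q * (pcompose P (monom 1 q) - P ^ q)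
     - (([:a:] ^ q - [:a:]) + ((pCons a P) ^ q - [:a:] ^ q - (monom 1 1 * P) ^ q))"
    by (meson dvd_diff dvd_add)
  also have "\<dots> = pcompose (pCons a P) (monom 1 q) - pCons a P ^ q"
    by (simp add: pcompose_pCons power_mult_distrib monom_power algebra_simps)
  finally show ?case .
qed

lemma ex_pcompose_monom_prime:
  fixes P :: "int poly"
  assumes "prime q"
  obtains S where "pcompose P (monom 1 q) = P ^ q + smult (int q) S"
proof -
  from pcompose_monom_prime_cong[OF assms, of P] obtain S
    where "pcompose P (monom 1 q) - P ^ q = [:int q:] * S" by (auto elim: dvdE)
  then have "pcompose P (monom 1 q) = P ^ q + smult (int q) S" by (simp add: algebra_simps)
  then show thesis by (rule that)
qed

text \<open>
  Let \<open>X\<^sup>d - 1 = g h\<close> with the minimal polynomial \<open>g\<close> of \<open>z\<close>. If \<open>h (z\<^sup>q) = 0\<close>, then \<open>h (z)\<^sup>q\<close> is divisible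
  by \<open>q\<close>, and \<open>d = z g' (z) h (z)\<close> gives that \<open>q\<close> divides \<open>d\<^sup>q\<close> in \<open>\<int>[z]\<close>, hence in \<open>\<int>\<close>.
\<close>

lemma ev_root_prime_power:
  fixes z :: complex
  assumes d: "d > 0" "z ^ d = 1" and q: "prime q" "\<not> q dvd d" and P: "ev P z = 0"
  shows "ev P (z ^ q) = 0"
proof -
  obtain g where g: "lead_coeff g = 1" "ev g z = 0" "\<And>P. ev P z = 0 \<Longrightarrow> g dvd P"
    using ex_minimal_polynomial[OF d] by blast
  have "ev (monom 1 d - 1) z = 0" using d by simp
  then obtain h where h: "monom 1 d - 1 = g * h" using g(3) dvdE by blast
  have "ev g (z ^ q) = 0"
  proof (rule ccontr)
    assume "ev g (z ^ q) \<noteq> 0"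
    moreover have "ev g (z ^ q) * ev h (z ^ q) = ev (monom 1 d - 1) (z ^ q)"
      unfolding h by simp
    moreover have "\<dots> = 0" using d by (simp add: power_mult[symmetric] mult.commute[of q])
        (simp add: power_mult)
    ultimately have hz: "ev h (z ^ q) = 0" by simp
    obtain S where "pcompose h (monom 1 q) = h ^ q + smult (int q) S"
      by (rule ex_pcompose_monom_prime[OF q(1)])
    from arg_cong[OF this, of "\<lambda>P. ev P z"] hz have hS: "ev h z ^ q = - (of_nat q * ev S z)"
      by (simp add: add_eq_0_iff)
    have "pderiv (monom 1 d - 1) = pderiv g * h + g * pderiv h"
      unfolding h by (simp add: pderiv_mult)
    then have "monom (int d) (d - 1) = pderiv g * h + g * pderiv h"
      by (simp add: pderiv_diff pderiv_monom)
    from arg_cong[OF this, of "\<lambda>P. ev P z"] g(2)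
    have "of_nat d * z ^ (d - 1) = ev (pderiv g) z * ev h z" by simp
    moreover have "z ^ (d - 1) * z = 1" using d by (simp add: power_eq_if mult.commute)
    ultimately have "of_nat d = (z * ev (pderiv g) z) * ev h z"
      by (metis mult.assoc mult.commute mult.right_neutral)
    then have "of_nat d ^ q = (z * ev (pderiv g) z) ^ q * ev h z ^ q"
      by (simp only: power_mult_distrib)
    then have "ev ([:int d ^ q:] + smult (int q) ((monom 1 1 * pderiv g) ^ q * S)) z = 0"
      using hS by simp
    then have dvd: "g dvd [:int d ^ q:] + smult (int q) ((monom 1 1 * pderiv g) ^ q * S)"
      by (rule g(3))
    \<comment> \<open>Reduction modulo \<open>g\<close> descends from Z[z] to Z: what remains is a
      multiple of \<open>g\<close> of smaller degree, hence 0, and its constant coefficient shows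
      that \<open>q\<close> divides \<open>d ^ q\<close>.\<close>
    obtain a r where r: "(monom 1 1 * pderiv g) ^ q * S = g * a + r" "r = 0 \<or> degree r < degree g"
      using monic_division[OF g(1)] by metis
    have "g dvd [:int d ^ q:] + smult (int q) r + smult (int q) (g * a)"
      using dvd unfolding r(1) by (simp add: smult_add_right algebra_simps)
    then have "g dvd [:int d ^ q:] + smult (int q) r"
      by (subst (asm) dvd_add_left_iff) (auto intro: dvd_smult)
    moreover have "degree g > 0"
    proof (rule ccontr)
      assume "\<not> degree g > 0"
      then have "g = 1" using g(1) by (auto elim!: degree_eq_zeroE simp: one_pCons)
      with g(2) show False by simp
    qed
    then have "degree ([:int d ^ q:] + smult (int q) r) < degree g"
      using r(2) by (intro degree_add_less) auto
    ultimately have "[:int d ^ q:] + smult (int q) r = 0"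
      using dvd_imp_degree_le by (metis not_less)
    then have "coeff ([:int d ^ q:] + smult (int q) r) 0 = 0" by (simp only: coeff_0)
    then have "int d ^ q = int q * (- coeff r 0)" by simp
    then have "int q dvd int d ^ q" by (rule dvdI)
    then have "q dvd d ^ q" by (metis of_nat_dvd_iff of_nat_power)
    with q show False using prime_dvd_power by blast
  qed
  then show ?thesis using g(3)[OF P] by (auto elim!: dvdE)
qed

text \<open>Irreducibility of the cyclotomic polynomials in disguise. The prime factors of
  \<open>k\<close> are treated one at a time; each intermediate power of \<open>z\<close> is still a
  \<open>d\<close>-th root of unity.\<close>

lemma ev_root_coprime_power:
  fixes z :: complex
  assumes d: "d > 0" "z ^ d = 1" and k: "coprime k d" "k > 0" and P: "ev P z = 0"
  shows "ev P (z ^ k) = 0"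
  using k
proof (induction k rule: prime_divisors_induct)
  case zero
  then show ?case by simp
next
  case (unit x)
  then show ?case using P by simp
next
  case (factor p x)
  have "ev P (z ^ x) = 0" using factor by (intro factor.IH) auto
  moreover have "(z ^ x) ^ d = 1" using d by (metis power_mult mult.commute power_one)
  moreover have "\<not> p dvd d" using factor by (meson coprime_common_divisor dvd_triv_left not_prime_unit)
  ultimately have "ev P ((z ^ x) ^ p) = 0"
    using ev_root_prime_power[of d "z ^ x" p P] factor(1) d(1) by blast
  then show ?case by (simp add: power_mult[symmetric] mult.commute)
qed

section \<open>Primitive roots of unity\<close>

text \<open>The order of \<open>z\<close> is exactly \<open>d\<close>. The case \<open>d = 0\<close>
  describes the numbers that are not roots of unity, hence the assumptions \<open>d > 0\<close>
  below.\<close>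

definition primitive_root :: "nat \<Rightarrow> complex \<Rightarrow> bool" where
  "primitive_root d z \<longleftrightarrow> (\<forall>j::nat. z ^ j = 1 \<longleftrightarrow> d dvd j)"

lemma primitive_root_power_eq_1: "primitive_root d z \<Longrightarrow> z ^ d = 1"
  by (simp add: primitive_root_def)

lemma primitive_root_unique: "primitive_root d z \<Longrightarrow> primitive_root e z \<Longrightarrow> d = e"
  unfolding primitive_root_def by (meson dvd_antisym dvd_refl)

lemma primitive_root_cis: 
  assumes "d > 0"
  shows "primitive_root d (cis (2 * pi / real d))"
  unfolding primitive_root_def
proof
  fix j :: nat
  have "cis (2 * pi / real d) ^ j = cis (2 * pi * (real j / real d))"
    by (simp add: DeMoivre mult_ac)
  also have "\<dots> = 1 \<longleftrightarrow> real j / real d \<in> \<int>"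
  proof
    assume "cis (2 * pi * (real j / real d)) = 1"
    then have "cos (2 * pi * (real j / real d)) = 1" by (metis cis.simps(1) one_complex.simps(1))
    then obtain n :: int where "2 * pi * (real j / real d) = of_int n * 2 * pi"
      using cos_one_2pi_int by blast
    then have "2 * pi * (real j / real d) = 2 * pi * of_int n" by (simp only: mult_ac)
    then have "real j / real d = of_int n" by (subst (asm) mult_cancel_left) auto
    then show "real j / real d \<in> \<int>" by simp
  next
    assume "real j / real d \<in> \<int>"
    then show "cis (2 * pi * (real j / real d)) = 1" by (rule cis_multiple_2pi)
  qed
  also have "\<dots> \<longleftrightarrow> d dvd j"
  proof
    assume "real j / real d \<in> \<int>"
    then obtain n :: int where n: "real j / real d = of_int n" by (auto elim: Ints_cases)
    then have "real j = of_int (n * int d)" using assms by (simp add: field_simps)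
    then have "int j = n * int d" by (metis of_int_eq_iff of_int_of_nat_eq)
    then have "int d dvd int j" by simp
    then show "d dvd j" by simp
  next
    assume "d dvd j"
    then show "real j / real d \<in> \<int>" using assms by (auto elim!: dvdE)
  qed
  finally show "cis (2 * pi / real d) ^ j = 1 \<longleftrightarrow> d dvd j" .
qed

lemma root_of_unity_primitive:
  assumes "N > 0" "z ^ N = (1 :: complex)"
  obtains d where "d > 0" "d dvd N" "primitive_root d z"
proof -
  define d where "d = (LEAST j. j > 0 \<and> z ^ j = 1)"
  have d: "d > 0 \<and> z ^ d = 1"
    unfolding d_def by (rule LeastI[of _ N]) (use assms in simp)
  have min: "d \<le> j" if "j > 0" "z ^ j = 1" for j
    unfolding d_def by (rule Least_le) (use that in simp)
  have "d dvd j" if "z ^ j = 1" for j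
  proof -
    have "z ^ j = z ^ (d * (j div d) + j mod d)" by simp
    also have "\<dots> = (z ^ d) ^ (j div d) * z ^ (j mod d)" by (simp only: power_add power_mult)
    finally have "z ^ (j mod d) = 1" using d that by simp
    then have "j mod d = 0" using min[of "j mod d"] d by (metis mod_less_divisor not_le not_gr_zero)
    then show ?thesis by auto
  qed
  moreover have "z ^ j = 1" if "d dvd j" for j
    using that d by (auto elim!: dvdE simp: power_mult)
  ultimately have "primitive_root d z" unfolding primitive_root_def by blast
  then show thesis using that d assms by (auto simp: primitive_root_def)
qed

lemma primitive_root_power:
  assumes "primitive_root (d * e) z" "e > 0"
  shows "primitive_root d (z ^ e)"
  using assms unfolding primitive_root_def
  by (auto simp: power_mult[symmetric] mult.commute[of d])

lemma primitive_root_power_coprime: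
  assumes "primitive_root d z" "coprime k d"
  shows "primitive_root d (z ^ k)"
  using assms unfolding primitive_root_def
  by (auto simp: power_mult[symmetric] coprime_dvd_mult_right_iff coprime_commute)

lemma primitive_root_power_inj:
  assumes "primitive_root d z" "d > 0"
  shows "inj_on (\<lambda>k. z ^ k) {1..d}"
proof (rule linorder_inj_onI')
  fix i j assume ij: "i \<in> {1..d}" "j \<in> {1..d}" "i < j"
  show "z ^ i \<noteq> z ^ j"
  proof
    assume eq: "z ^ i = z ^ j"
    have "z \<noteq> 0" using primitive_root_power_eq_1[OF assms(1)] assms(2) by (auto simp: power_0_left)
    moreover have "z ^ j = z ^ i * z ^ (j - i)" using ij by (simp flip: power_add)
    ultimately have "z ^ (j - i) = 1" using eq by simp
    then have "d dvd j - i" using assms by (simp add: primitive_root_def)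
    then have "d \<le> j - i" using ij by (intro dvd_imp_le) auto
    with ij show False by auto
  qed
qed

lemma primitive_root_powers:
  assumes "primitive_root d z" "d > 0"
  shows "(\<lambda>k. z ^ k) ` {1..d} = {w. w ^ d = 1}"
proof (rule card_subset_eq)
  show "finite {w :: complex. w ^ d = 1}" using assms by (intro finite_roots_unity) auto
  show "(\<lambda>k. z ^ k) ` {1..d} \<subseteq> {w. w ^ d = 1}"
    using primitive_root_power_eq_1[OF assms(1)]
    by (auto simp: power_mult[symmetric] mult.commute[of _ d]) (simp add: power_mult)
  show "card ((\<lambda>k. z ^ k) ` {1..d}) = card {w :: complex. w ^ d = 1}"
    unfolding card_image[OF primitive_root_power_inj[OF assms]] using assms
    by (simp add: card_roots_unity_eq)
qed

lemma primitive_roots_conv_totatives: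
  assumes "primitive_root d z" "d > 0"
  shows "bij_betw (\<lambda>k. z ^ k) (totatives d) {w. primitive_root d w}"
proof (rule bij_betw_imageI)
  show "inj_on (\<lambda>k. z ^ k) (totatives d)"
    using primitive_root_power_inj[OF assms] by (rule inj_on_subset) (auto simp: totatives_def)
  show "(\<lambda>k. z ^ k) ` totatives d = {w. primitive_root d w}"
  proof safe
    fix k assume "k \<in> totatives d"
    then show "primitive_root d (z ^ k)"
      using assms by (intro primitive_root_power_coprime) (auto simp: totatives_def)
  next
    fix w assume w: "primitive_root d w"
    then have "w \<in> (\<lambda>k. z ^ k) ` {1..d}"
      using primitive_root_powers[OF assms] primitive_root_power_eq_1 by blast
    then obtain k where k: "k \<in> {1..d}" "w = z ^ k" by blast
    have "coprime k d"
    proof (rule coprimeI)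
      fix c assume c: "c dvd k" "c dvd d"
      then obtain k' d' where kd: "k = c * k'" "d = c * d'" by (auto elim!: dvdE)
      have "w ^ d' = (z ^ d) ^ k'"
        unfolding k(2) kd by (simp flip: power_mult add: mult_ac)
      also have "\<dots> = 1" using primitive_root_power_eq_1[OF assms(1)] by simp
      finally have "d dvd d'" using w by (simp add: primitive_root_def)
      then show "is_unit c" using assms(2) unfolding kd by auto
    qed
    then have "k \<in> totatives d" using k by (auto simp: totatives_def)
    then show "w \<in> (\<lambda>k. z ^ k) ` totatives d" using k by blast
  qed
qed

lemma card_primitive_roots:
  assumes "d > 0"
  shows "card {w. primitive_root d w} = totient d" "finite {w. primitive_root d w}"
proof -
  have *: "bij_betw (\<lambda>k. cis (2 * pi / real d) ^ k) (totatives d) {w. primitive_root d w}"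
    by (intro primitive_roots_conv_totatives primitive_root_cis assms)
  show "card {w. primitive_root d w} = totient d"
    using bij_betw_same_card[OF *] by (simp add: totient_def)
  show "finite {w. primitive_root d w}"
    using bij_betw_finite[OF *] by simp
qed

lemma primitive_root_1_iff: "primitive_root 1 z \<longleftrightarrow> z = 1"
  unfolding primitive_root_def by (auto dest: spec[of _ 1])

lemma primitive_root_ne_0: "primitive_root d z \<Longrightarrow> d > 0 \<Longrightarrow> z \<noteq> 0"
  using primitive_root_power_eq_1[of d z] by (auto simp: power_0_left)

lemma norm_primitive_root: "primitive_root d z \<Longrightarrow> d > 0 \<Longrightarrow> norm z = 1"
  by (metis primitive_root_power_eq_1 norm_power norm_one power_eq_1_iff norm_ge_zero not_gr_zero)

text \<open>Stands in for Galois conjugation: any primitive \<open>d\<close>-th root of unity is a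
  power of any other one with exponent coprime to \<open>d\<close>.\<close>

lemma ev_eq_0_primitive_roots:
  assumes "primitive_root d z" "primitive_root d w" "d > 0" "ev P z = 0"
  shows "ev P w = 0"
proof -
  obtain k where "k \<in> totatives d" "w = z ^ k"
    using primitive_roots_conv_totatives[OF assms(1,3)] assms(2) 
    by (auto simp: bij_betw_def)
  then show ?thesis
    using ev_root_coprime_power[of d z k P] assms primitive_root_power_eq_1[OF assms(1)]
    by (auto simp: totatives_def)
qed

section \<open>Cyclotomic polynomials\<close>

text \<open>Choosing a minimal polynomial makes divisibility by \<open>cyc d\<close> a matter of
  evaluation at one point. That its roots are exactly the primitive \<open>d\<close>-th roots of
  unity follows in \<open>ev_cyc_eq_0_iff\<close>.\<close>

definition cyc :: "nat \<Rightarrow> int poly" where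
  "cyc d = (SOME g. lead_coeff g = 1 \<and> ev g (cis (2 * pi / real d)) = 0 \<and>
     (\<forall>P. ev P (cis (2 * pi / real d)) = 0 \<longrightarrow> g dvd P))"

lemma cyc_spec:
  assumes "d > 0"
  shows "lead_coeff (cyc d) = 1 \<and> ev (cyc d) (cis (2 * pi / real d)) = 0 \<and>
     (\<forall>P. ev P (cis (2 * pi / real d)) = 0 \<longrightarrow> cyc d dvd P)"
  unfolding cyc_def
  by (rule someI_ex)
     (use ex_minimal_polynomial[OF assms] primitive_root_power_eq_1[OF primitive_root_cis[OF assms]]
      in blast)

lemma lead_coeff_cyc: "d > 0 \<Longrightarrow> lead_coeff (cyc d) = 1"
  using cyc_spec[of d] by simp

lemma cyc_ne_0: "d > 0 \<Longrightarrow> cyc d \<noteq> 0"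
  using lead_coeff_cyc[of d] by auto

lemma ev_cyc_primitive_root: "d > 0 \<Longrightarrow> primitive_root d z \<Longrightarrow> ev (cyc d) z = 0"
  using cyc_spec[of d] ev_eq_0_primitive_roots[OF primitive_root_cis, of d z] by blast

lemma cyc_dvd_iff:
  assumes "d > 0" "primitive_root d z"
  shows "cyc d dvd P \<longleftrightarrow> ev P z = 0"
proof
  assume "cyc d dvd P"
  then show "ev P z = 0" using ev_cyc_primitive_root[OF assms] by (auto elim!: dvdE)
next
  assume "ev P z = 0"
  then have "ev P (cis (2 * pi / real d)) = 0"
    using ev_eq_0_primitive_roots[OF assms(2) primitive_root_cis] assms(1) by blast
  then show "cyc d dvd P" using cyc_spec[OF assms(1)] by blast
qed

lemma prime_elem_cyc:
  assumes "d > 0"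
  shows "prime_elem (cyc d)"
proof (rule prime_elemI)
  show "cyc d \<noteq> 0" using assms by (rule cyc_ne_0)
  show "\<not> cyc d dvd 1" using cyc_dvd_iff[OF assms primitive_root_cis[OF assms], of 1] by simp
  fix P Q assume "cyc d dvd P * Q"
  then show "cyc d dvd P \<or> cyc d dvd Q"
    by (simp add: cyc_dvd_iff[OF assms primitive_root_cis[OF assms]])
qed

lemma cyc_dvd_monom_minus_one: "d > 0 \<Longrightarrow> cyc d dvd monom 1 d - 1"
  using cyc_dvd_iff[OF _ primitive_root_cis, of d "monom 1 d - 1"] primitive_root_cis
  by (simp add: primitive_root_power_eq_1)

text \<open>A root of \<open>cyc d\<close> is a \<open>d\<close>-th root of unity, of some order
  \<open>e\<close> dividing \<open>d\<close>, so \<open>cyc e\<close> divides \<open>cyc d\<close>.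
  The cofactor cannot be a multiple of \<open>cyc d\<close>; hence \<open>cyc e\<close> vanishes at
  a primitive \<open>d\<close>-th root of unity, which forces \<open>d\<close> to divide
  \<open>e\<close>.\<close>

lemma ev_cyc_eq_0_iff:
  assumes "d > 0"
  shows "ev (cyc d) z = 0 \<longleftrightarrow> primitive_root d z"
proof
  assume z: "ev (cyc d) z = 0"
  obtain u where u: "monom 1 d - 1 = cyc d * u"
    using cyc_dvd_monom_minus_one[OF assms] dvdE by blast
  have "z ^ d = 1" using arg_cong[OF u, of "\<lambda>P. ev P z"] z by simp
  then obtain e where e: "e > 0" "e dvd d" "primitive_root e z"
    using root_of_unity_primitive assms by metis
  have "cyc e dvd cyc d" using cyc_dvd_iff[OF e(1,3)] z by simp
  then obtain u where u: "cyc d = cyc e * u" by (auto elim!: dvdE)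
  let ?w = "cis (2 * pi / real d)"
  have w: "primitive_root d ?w" by (rule primitive_root_cis) fact
  have e0: "ev (cyc e) ?w = 0"
  proof (rule ccontr)
    assume "ev (cyc e) ?w \<noteq> 0"
    then have "ev u ?w = 0"
      using ev_cyc_primitive_root[OF assms w] unfolding u by simp
    then have "cyc d dvd u" using cyc_dvd_iff[OF assms w] by simp
    then obtain v where "u = cyc d * v" by (auto elim!: dvdE)
    then have "cyc d * 1 = cyc d * (cyc e * v)" using u by (metis mult.left_commute mult.right_neutral)
    then have "1 = cyc e * v" using cyc_ne_0[OF assms] mult_left_cancel by blast
    then have "cyc e dvd 1" by (rule dvdI)
    with prime_elem_cyc[OF e(1)] show False by auto
  qed
  obtain v where v: "monom 1 e - 1 = cyc e * v"
    using cyc_dvd_monom_minus_one[OF e(1)] dvdE by blast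
  have "?w ^ e = 1" using arg_cong[OF v, of "\<lambda>P. ev P ?w"] e0 by simp
  then have "d dvd e" using w by (simp add: primitive_root_def)
  with e show "primitive_root d z" by (metis dvd_antisym)
qed (use assms in \<open>auto intro: ev_cyc_primitive_root\<close>)

lemma cyc_dvd_cyc_iff: "d > 0 \<Longrightarrow> e > 0 \<Longrightarrow> cyc d dvd cyc e \<longleftrightarrow> d = e"
  using cyc_dvd_iff[OF _ primitive_root_cis, of d "cyc e"] ev_cyc_eq_0_iff[of e]
    primitive_root_cis[of d] primitive_root_unique by auto

text \<open>The lower bound counts roots. For the upper bound write X^d - 1 as
  \<open>cyc d * u\<close>: its \<open>d\<close> distinct roots number at most
  \<open>totient d + degree u\<close>, while \<open>d\<close> is the sum of the two degrees.\<close>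

lemma degree_cyc:
  assumes "d > 0"
  shows "degree (cyc d) = totient d"
proof (rule antisym)
  have roots: "{z. ev (cyc d) z = 0} = {z. primitive_root d z}"
    using ev_cyc_eq_0_iff[OF assms] by blast
  show "totient d \<le> degree (cyc d)"
    using card_ev_roots[OF cyc_ne_0[OF assms]] card_primitive_roots(1)[OF assms] roots by simp
  obtain u where u: "monom 1 d - 1 = cyc d * u"
    using cyc_dvd_monom_minus_one[OF assms] dvdE by blast
  have u0: "u \<noteq> 0" using u monom_minus_one(2)[OF assms] assms by auto
  have "{z :: complex. z ^ d = 1} = {z. ev (monom 1 d - 1) z = 0}" by simp
  also have "\<dots> = {z. ev (cyc d) z = 0} \<union> {z. ev u z = 0}" unfolding u by auto
  finally have "d = card ({z. ev (cyc d) z = 0} \<union> {z. ev u z = 0})"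
    using card_roots_unity_eq[of d] assms by simp
  also have "\<dots> \<le> card {z. ev (cyc d) z = 0} + card {z. ev u z = 0}" by (rule card_Un_le)
  also have "\<dots> \<le> totient d + degree u"
    using card_ev_roots(2)[OF u0] card_primitive_roots(1)[OF assms] roots by simp
  finally have "d \<le> totient d + degree u" .
  moreover have "d = degree (cyc d) + degree u"
    using monom_minus_one(2)[OF assms] u0 cyc_ne_0[OF assms] unfolding u by (simp add: degree_mult_eq)
  ultimately show "degree (cyc d) \<le> totient d" by simp
qed

text \<open>Otherwise \<open>z\<close> would be a double root of X^d - 1.\<close>

lemma ev_pderiv_cyc_ne_0:
  assumes "d > 0" "primitive_root d z"
  shows "ev (pderiv (cyc d)) z \<noteq> 0"
proof
  assume 0: "ev (pderiv (cyc d)) z = 0"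
  obtain u where u: "monom 1 d - 1 = cyc d * u"
    using cyc_dvd_monom_minus_one[OF assms(1)] dvdE by blast
  have "pderiv (monom 1 d - 1) = pderiv (cyc d) * u + cyc d * pderiv u"
    unfolding u by (simp add: pderiv_mult)
  then have "monom (int d) (d - 1) = pderiv (cyc d) * u + cyc d * pderiv u"
    by (simp add: pderiv_diff pderiv_monom)
  from arg_cong[OF this, of "\<lambda>P. ev P z"] 0 ev_cyc_primitive_root[OF assms]
  have "of_nat d * z ^ (d - 1) = 0" by simp
  then show False using assms primitive_root_ne_0[OF assms(2,1)] by simp
qed

section \<open>Divisibility by products of prime elements\<close>

lemma prime_elem_dvd_prod:
  assumes "finite S" "prime_elem p" "p dvd prod f S"
  shows "\<exists>s\<in>S. p dvd f s"
  using assms(1,3)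
proof (induction S)
  case empty
  then show ?case using assms(2) by (simp add: prime_elem_def)
next
  case (insert x S)
  then show ?case using assms(2) by (auto simp: prime_elem_dvd_mult_iff)
qed

lemma primes_power_prod_dvd:
  fixes R :: "'a :: {idom, algebraic_semidom}"
  assumes "finite S" "\<And>s. s \<in> S \<Longrightarrow> prime_elem (f s)" "\<And>s. s \<in> S \<Longrightarrow> f s ^ j s dvd R"
    "\<And>s t. s \<in> S \<Longrightarrow> t \<in> S \<Longrightarrow> s \<noteq> t \<Longrightarrow> \<not> f s dvd f t"
  shows "(\<Prod>s\<in>S. f s ^ j s) dvd R"
  using assms
proof (induction S)
  case (insert x S)
  then have "(\<Prod>s\<in>S. f s ^ j s) dvd R" by simp
  then obtain H where H: "R = (\<Prod>s\<in>S. f s ^ j s) * H" by (auto elim!: dvdE)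
  have px: "prime_elem (f x)" using insert by simp
  have "\<not> f x dvd (\<Prod>s\<in>S. f s ^ j s)"
  proof
    assume "f x dvd (\<Prod>s\<in>S. f s ^ j s)"
    then obtain s where s: "s \<in> S" "f x dvd f s ^ j s"
      using prime_elem_dvd_prod[OF insert(1) px] by blast
    then have "f x dvd f s" using px prime_elem_dvd_power by blast
    then show False using insert s by auto
  qed
  moreover have "f x ^ j x dvd (\<Prod>s\<in>S. f s ^ j s) * H" using insert.prems(2)[of x] H by simp
  ultimately have "f x ^ j x dvd H"
    using prime_power_dvd_multD[OF px, of "j x" "\<Prod>s\<in>S. f s ^ j s" H] 
    by (cases "j x = 0") (simp, blast)
  then have "(\<Prod>s\<in>S. f s ^ j s) * f x ^ j x dvd R" unfolding H by (rule mult_dvd_mono[OF dvd_refl])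
  then show ?case using insert(1,2) by (simp add: mult.commute)
qed simp

lemma sum_totient_le_degree:
  assumes "finite D" "\<And>d. d \<in> D \<Longrightarrow> d > 0 \<and> cyc d dvd P" "P \<noteq> 0"
  shows "(\<Sum>d\<in>D. totient d) \<le> degree P"
proof -
  have "(\<Prod>d\<in>D. cyc d ^ 1) dvd P"
    by (rule primes_power_prod_dvd) (use assms in \<open>auto simp: prime_elem_cyc cyc_dvd_cyc_iff\<close>)
  then have "degree (\<Prod>d\<in>D. cyc d) \<le> degree P"
    using assms(3) by (intro dvd_imp_degree_le) auto
  moreover have "degree (\<Prod>d\<in>D. cyc d) = (\<Sum>d\<in>D. totient d)"
    using assms by (subst degree_prod_eq_sum_degree) (auto simp: cyc_ne_0 degree_cyc)
  ultimately show ?thesis by simp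
qed

section \<open>Norms of cyclotomic integers\<close>

text \<open>The remainder of \<open>Q\<close> modulo \<open>cyc d\<close> has degree below
  \<open>totient d\<close> but takes the value \<open>c\<close> at \<open>totient d\<close> points.
  So it is the constant \<open>c\<close>, and its coefficients are integers.\<close>

lemma constant_on_primitive_roots:
  assumes "d > 0" "\<And>w. primitive_root d w \<Longrightarrow> ev Q w = c"
  shows "c \<in> \<int>"
proof -
  obtain q r where qr: "Q = cyc d * q + r" "r = 0 \<or> degree r < degree (cyc d)"
    using monic_division[OF lead_coeff_cyc[OF assms(1)]] by blast
  have evr: "ev r w = c" if "primitive_root d w" for w
    using assms(2)[OF that] ev_cyc_primitive_root[OF assms(1) that] by (simp add: qr(1))
  have tot: "totient d > 0" using assms(1) by simp
  define R :: "complex poly" where "R = map_poly of_int r - [:c:]"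
  have "degree (map_poly of_int r :: complex poly) < totient d"
    using qr(2) tot degree_cyc[OF assms(1)] by (auto simp: degree_map_poly)
  then have degR: "degree R < totient d"
    unfolding R_def using tot by (intro degree_diff_less) auto
  have "R = 0"
  proof (rule ccontr)
    assume R: "R \<noteq> 0"
    have "totient d = card {w. primitive_root d w}" using card_primitive_roots(1)[OF assms(1)] by simp
    also have "\<dots> \<le> card {w. poly R w = 0}"
      using evr by (intro card_mono poly_roots_finite R) (auto simp: R_def ev_def)
    also have "\<dots> \<le> degree R" by (rule card_poly_roots_bound) fact
    finally show False using degR by simp
  qed
  then have "map_poly of_int r = [:c:]" by (simp add: R_def)
  then have "coeff (map_poly of_int r) 0 = c" by simp
  then have "c = of_int (coeff r 0)" by (simp add: coeff_map_poly)
  then show ?thesis by simp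
qed

text \<open>The product of \<open>ev W w\<close> over all primitive roots is a norm, hence a nonzero
  integer. Integrality holds because the product over the totatives \<open>k\<close> of W(X^k) takes
  this same value at every primitive root: the powers merely permute the roots.\<close>

lemma ex_conjugate_norm_ge_1:
  assumes "d > 0" "primitive_root d z" "ev W z \<noteq> 0"
  shows "\<exists>w. primitive_root d w \<and> norm (ev W w) \<ge> 1"
proof (rule ccontr)
  assume "\<not> ?thesis"
  then have less: "norm (ev W w) < 1" if "primitive_root d w" for w using that by force
  define c where "c = (\<Prod>w\<in>{w. primitive_root d w}. ev W w)"
  have "ev (\<Prod>k\<in>totatives d. pcompose W (monom 1 k)) w = c" if "primitive_root d w" for w
    unfolding c_def ev_prod
    using prod.reindex_bij_betw[OF primitive_roots_conv_totatives[OF that assms(1)], of "ev W"] by simp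
  then have "c \<in> \<int>" by (rule constant_on_primitive_roots[OF assms(1)])
  then obtain n where n: "c = of_int n" by (auto elim: Ints_cases)
  have "ev W w \<noteq> 0" if "primitive_root d w" for w
    using ev_eq_0_primitive_roots[OF that assms(2,1)] assms(3) by blast
  then have "c \<noteq> 0"
    unfolding c_def using card_primitive_roots(2)[OF assms(1)] by auto
  then have "norm c \<ge> 1" unfolding n by simp
  moreover have "norm c < (\<Prod>w\<in>{w. primitive_root d w}. 1)"
    unfolding c_def prod_norm[symmetric]
    by (rule prod_mono_strict[where i = z])
      (use less card_primitive_roots[OF assms(1)] assms(2) in \<open>auto intro: less_imp_le\<close>)
  ultimately show False by simp
qed

section \<open>Cyclotomic polynomials modulo a prime\<close>

lemma monic_dvd_eq:
  fixes f g :: "int poly"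
  assumes "lead_coeff f = 1" "lead_coeff g = 1" "f dvd g" "degree f = degree g"
  shows "f = g"
proof -
  obtain u where u: "g = f * u" using assms(3) by (auto elim: dvdE)
  have "f \<noteq> 0" "u \<noteq> 0" using assms u by auto
  then have "degree u = 0" using assms(4) u by (simp add: degree_mult_eq)
  moreover have "lead_coeff u = 1" using assms u lead_coeff_mult[of f u] by simp
  ultimately have "u = 1" by (auto elim!: degree_eq_zeroE simp: one_pCons)
  with u show ?thesis by simp
qed

lemma pcompose_monom_monic:
  fixes f :: "int poly"
  assumes "lead_coeff f = 1" "k > 0"
  shows "lead_coeff (pcompose f (monom 1 k)) = 1" "degree (pcompose f (monom 1 k)) = degree f * k"
proof -
  have "degree (monom 1 k :: int poly) > 0" using assms by (simp add: degree_monom_eq)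
  from lead_coeff_comp[OF this, of f] assms show "lead_coeff (pcompose f (monom 1 k)) = 1"
    by (simp only: lead_coeff_monom power_one mult_1)
qed (simp add: degree_pcompose degree_monom_eq)

lemma cyc_dvd_pcompose_cyc:
  assumes "d > 0" "e > 0"
  shows "cyc (d * e) dvd pcompose (cyc d) (monom 1 e)"
proof -
  have "d * e > 0" using assms by simp
  note z = primitive_root_cis[OF this]
  show ?thesis
    using cyc_dvd_iff[OF \<open>d * e > 0\<close> z] ev_cyc_primitive_root[OF assms(1) primitive_root_power[OF z assms(2)]]
    by simp
qed

lemma cyc_dvd_pcompose_cyc_coprime:
  assumes "d > 0" "e > 0" "coprime e d"
  shows "cyc d dvd pcompose (cyc d) (monom 1 e)"
  using cyc_dvd_iff[OF assms(1) primitive_root_cis[OF assms(1)], of "pcompose (cyc d) (monom 1 e)"]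
    ev_cyc_primitive_root[OF assms(1) primitive_root_power_coprime[OF primitive_root_cis[OF assms(1)] assms(3)]]
  by simp

text \<open>Comparing degrees, \<open>cyc m * cyc (m * p)\<close> is the composition of
  \<open>cyc m\<close> with X^p, which is congruent to \<open>cyc m ^ p\<close> modulo
  \<open>p\<close>. Cancelling \<open>cyc m\<close> is possible because the error term vanishes at
  the primitive \<open>m\<close>-th roots of unity as well.\<close>

lemma cyc_mult_prime_cong:
  assumes "m > 0" "prime p" "\<not> p dvd m"
  shows "\<exists>s. cyc (m * p) = cyc m ^ (p - 1) + smult (int p) s"
proof -
  have p: "p > 0" "p \<ge> 2" using assms(2) prime_gt_0_nat prime_ge_2_nat by auto
  have mp: "m * p > 0" using assms p by simp
  have cop: "coprime p m" using assms prime_imp_coprime by blast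
  define G where "G = pcompose (cyc m) (monom 1 p)"
  obtain u where u: "G = cyc m * u"
    using cyc_dvd_pcompose_cyc_coprime[OF assms(1) p(1) cop] unfolding G_def by (auto elim: dvdE)
  have "\<not> cyc (m * p) dvd cyc m"
    using cyc_dvd_cyc_iff[OF mp assms(1)] p assms by simp
  moreover have "cyc (m * p) dvd cyc m * u"
    using cyc_dvd_pcompose_cyc[OF assms(1) p(1)] unfolding G_def[symmetric] u .
  ultimately have "cyc (m * p) dvd u" using prime_elem_cyc[OF mp] prime_elem_dvd_multD by blast
  then have dvd: "cyc m * cyc (m * p) dvd G" unfolding u by (intro mult_dvd_mono) auto
  have "cyc m * cyc (m * p) = G"
  proof (rule monic_dvd_eq)
    show "lead_coeff (cyc m * cyc (m * p)) = 1"
      using lead_coeff_cyc[OF mp] lead_coeff_cyc[OF assms(1)] by (simp add: lead_coeff_mult del: degree_mult_eq)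
    show "lead_coeff G = 1"
      unfolding G_def by (rule pcompose_monom_monic) (use assms p lead_coeff_cyc in auto)
    show "cyc m * cyc (m * p) dvd G" by fact
    have "degree (cyc m * cyc (m * p)) = totient m + totient (m * p)"
      using cyc_ne_0[OF mp] cyc_ne_0[OF assms(1)] mp assms(1) by (simp add: degree_mult_eq degree_cyc)
    also have "totient (m * p) = totient m * (p - 1)"
      using cop assms(2) by (simp add: totient_mult_coprime coprime_commute totient_prime)
    also have "totient m + \<dots> = totient m * p" using p by (simp add: algebra_simps)
    also have "\<dots> = degree G"
      unfolding G_def using pcompose_monom_monic(2)[OF lead_coeff_cyc[OF assms(1)] p(1)]
        degree_cyc[OF assms(1)] by simp
    finally show "degree (cyc m * cyc (m * p)) = degree G" .
  qed
  moreover obtain S where S: "G = cyc m ^ p + smult (int p) S"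
    using ex_pcompose_monom_prime[OF assms(2)] unfolding G_def by blast
  ultimately have eq: "cyc m * cyc (m * p) = cyc m * cyc m ^ (p - 1) + smult (int p) S"
    using p(1) by (simp add: power_eq_if)
  let ?z = "cis (2 * pi / real m)"
  have "ev S ?z = 0"
    using arg_cong[OF eq, of "\<lambda>P. ev P ?z"] p ev_cyc_primitive_root[OF assms(1) primitive_root_cis[OF assms(1)]]
    by simp
  then have "cyc m dvd S" using cyc_dvd_iff[OF assms(1) primitive_root_cis[OF assms(1)]] by blast
  then obtain s where "S = cyc m * s" by (auto elim: dvdE)
  with eq have "cyc m * cyc (m * p) = cyc m * (cyc m ^ (p - 1) + smult (int p) s)"
    by (simp add: algebra_simps)
  then have "cyc (m * p) = cyc m ^ (p - 1) + smult (int p) s"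
    using cyc_ne_0[OF assms(1)] mult_left_cancel by blast
  then show ?thesis by blast
qed

lemma cyc_mult_prime_power_Suc:
  assumes "m > 0" "prime p" "\<not> p dvd m"
  shows "cyc (m * p ^ Suc b) = pcompose (cyc (m * p)) (monom 1 (p ^ b))"
proof (rule monic_dvd_eq)
  have p: "p > 0" using assms(2) prime_gt_0_nat by auto
  have mp: "m * p > 0" "m * p ^ Suc b > 0" "p ^ b > 0" using assms p by simp_all
  have cop: "coprime m p" using assms prime_imp_coprime coprime_commute by blast
  show "lead_coeff (cyc (m * p ^ Suc b)) = 1" using mp(2) by (rule lead_coeff_cyc)
  show "lead_coeff (pcompose (cyc (m * p)) (monom 1 (p ^ b))) = 1"
    using pcompose_monom_monic(1)[OF lead_coeff_cyc[OF mp(1)] mp(3)] .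
  show "cyc (m * p ^ Suc b) dvd pcompose (cyc (m * p)) (monom 1 (p ^ b))"
    using cyc_dvd_pcompose_cyc[OF mp(1,3)] by (simp add: mult.assoc)
  have "degree (cyc (m * p ^ Suc b)) = totient m * (p ^ b * (p - 1))"
    using degree_cyc[OF mp(2)] cop assms(2) 
    by (simp add: totient_mult_coprime totient_prime_power_Suc del: power_Suc)
  also have "\<dots> = totient (m * p) * p ^ b"
    using cop assms(2) by (simp add: totient_mult_coprime totient_prime)
  also have "\<dots> = degree (pcompose (cyc (m * p)) (monom 1 (p ^ b)))"
    using pcompose_monom_monic(2)[OF lead_coeff_cyc[OF mp(1)] mp(3)] degree_cyc[OF mp(1)] by simp
  finally show "degree (cyc (m * p ^ Suc b)) = degree (pcompose (cyc (m * p)) (monom 1 (p ^ b)))" .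
qed

text \<open>The power \<open>z ^ p ^ b\<close> is again a primitive \<open>m\<close>-th root of
  unity, so only the multiple of \<open>p\<close> in \<open>cyc_mult_prime_cong\<close> survives.
  The polynomial \<open>s\<close> does not depend on \<open>z\<close>, which lets its values at all
  conjugates enter one norm.\<close>

lemma ev_cyc_mult_prime_power:
  assumes "m > 0" "prime p" "\<not> p dvd m" "a > 0"
  shows "\<exists>s. \<forall>z. primitive_root m z \<longrightarrow> ev (cyc (m * p ^ a)) z = of_nat p * ev s z"
proof -
  obtain b where a: "a = Suc b" using assms(4) gr0_implies_Suc by blast
  obtain s where s: "cyc (m * p) = cyc m ^ (p - 1) + smult (int p) s"
    using cyc_mult_prime_cong[OF assms(1-3)] by blast
  have p: "p > 1" using assms(2) prime_gt_1_nat by blast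
  have cop: "coprime (p ^ b) m" using prime_imp_coprime[OF assms(2,3)] by simp
  have "ev (cyc (m * p ^ a)) z = of_nat p * ev (pcompose s (monom 1 (p ^ b))) z"
    if "primitive_root m z" for z
  proof -
    have "ev (cyc (m * p ^ a)) z = ev (cyc m) (z ^ p ^ b) ^ (p - 1) + of_nat p * ev s (z ^ p ^ b)"
      unfolding a cyc_mult_prime_power_Suc[OF assms(1-3)] s by simp
    also have "ev (cyc m) (z ^ p ^ b) = 0"
      using ev_cyc_primitive_root[OF assms(1) primitive_root_power_coprime[OF that cop]] .
    finally show ?thesis using p by simp
  qed
  then show ?thesis by blast
qed

section \<open>Derivatives at primitive roots\<close>

text \<open>At a zero of \<open>g\<close> only the term survives in which every derivative falls on
  a factor \<open>g\<close>. The cofactor \<open>R\<close> changes in each step of the induction and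
  is therefore arbitrary.\<close>

lemma ev_higher_pderiv_power_mult:
  assumes "ev g z = 0"
  shows "ev ((pderiv ^^ i) (g ^ i * R)) z = fact i * ev (pderiv g) z ^ i * ev R z"
proof (induction i arbitrary: R)
  case (Suc i)
  have "pderiv (g ^ Suc i * R) = g ^ i * (smult (int (Suc i)) (pderiv g * R) + g * pderiv R)"
    unfolding pderiv_mult[of "g ^ Suc i"] pderiv_power_Suc
    by (simp add: algebra_simps)
  then have "(pderiv ^^ Suc i) (g ^ Suc i * R) =
      (pderiv ^^ i) (g ^ i * (smult (int (Suc i)) (pderiv g * R) + g * pderiv R))"
    by (simp only: funpow_Suc_right o_apply)
  then have "ev ((pderiv ^^ Suc i) (g ^ Suc i * R)) z =
      fact i * ev (pderiv g) z ^ i * ev (smult (int (Suc i)) (pderiv g * R) + g * pderiv R) z"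
    by (simp only: Suc.IH)
  then show ?case using assms by (simp add: algebra_simps)
qed simp

definition poly_l1 :: "int poly \<Rightarrow> real" where
  "poly_l1 P = (\<Sum>k\<le>degree P. real_of_int \<bar>coeff P k\<bar>)"

lemma poly_l1_nonneg: "poly_l1 P \<ge> 0"
  unfolding poly_l1_def by (intro sum_nonneg) auto

lemma norm_ev_le:
  assumes "norm z = 1"
  shows "norm (ev P z) \<le> poly_l1 P"
  unfolding ev_altdef poly_l1_def
  by (rule sum_norm_le) (simp add: norm_mult norm_power assms)

lemma poly_l1_pderiv_le: "poly_l1 (pderiv P) \<le> degree P * poly_l1 P"
proof (cases "degree P")
  case 0
  then have "pderiv P = 0" by (simp add: pderiv_eq_0_iff)
  then show ?thesis using 0 by (simp add: poly_l1_def)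
next
  case (Suc N)
  have "poly_l1 (pderiv P) = (\<Sum>k\<le>N. real (Suc k) * real_of_int \<bar>coeff P (Suc k)\<bar>)"
    unfolding poly_l1_def degree_pderiv Suc 
    by (simp add: coeff_pderiv abs_mult)
  also have "\<dots> \<le> (\<Sum>k\<le>N. real (Suc N) * real_of_int \<bar>coeff P (Suc k)\<bar>)"
    by (intro sum_mono mult_right_mono) auto
  also have "\<dots> = real (Suc N) * (\<Sum>k\<le>N. real_of_int \<bar>coeff P (Suc k)\<bar>)"
    by (simp only: sum_distrib_left)
  also have "\<dots> \<le> real (Suc N) * poly_l1 P"
    unfolding poly_l1_def Suc by (intro mult_left_mono) (simp_all add: sum.atMost_Suc_shift del: sum.atMost_Suc)
  finally show ?thesis unfolding Suc .
qed

lemma poly_l1_higher_pderiv_le: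
  "poly_l1 ((pderiv ^^ i) P) \<le> real (degree P) ^ i * poly_l1 P"
proof (induction i)
  case (Suc i)
  have deg: "degree ((pderiv ^^ i) P) \<le> degree P"
    by (induction i) (auto simp: degree_pderiv)
  have "poly_l1 ((pderiv ^^ Suc i) P) \<le> degree ((pderiv ^^ i) P) * poly_l1 ((pderiv ^^ i) P)"
    using poly_l1_pderiv_le by simp
  also have "\<dots> \<le> real (degree P) * (real (degree P) ^ i * poly_l1 P)"
    by (rule mult_mono) (use deg Suc poly_l1_nonneg in auto)
  finally show ?case by simp
qed simp

text \<open>After splitting off \<open>cyc m ^ i\<close>, the cofactor \<open>R\<close> still
  contains the powers of all \<open>cyc (m * p ^ e p)\<close>, and each of these yields a factor
  \<open>p\<close> at primitive \<open>m\<close>-th roots of unity. So the nonzero value of the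
  \<open>i\<close>-th derivative there is the integer product times a value of an integer polynomial
  \<open>W\<close>. Some conjugate of the latter has modulus at least 1, and there the coefficient
  bound for the derivative applies.\<close>

lemma prod_prime_multiplicity_cyc_le:
  fixes P :: "int poly"
  assumes m: "m > 0" and P: "P \<noteq> 0" and S: "finite S"
    and p: "\<And>p. p \<in> S \<Longrightarrow> prime p \<and> \<not> p dvd m \<and> e p > 0"
  shows "real (\<Prod>p\<in>S. p ^ multiplicity (cyc (m * p ^ e p)) P) \<le>
    poly_l1 P * real (degree P) ^ multiplicity (cyc m) P"
proof -
  define i where "i = multiplicity (cyc m) P"
  define j where "j = (\<lambda>p. multiplicity (cyc (m * p ^ e p)) P)"
  define f where "f = (\<lambda>p. cyc (m * p ^ e p))"
  have pos: "m * p ^ e p > 0" if "p \<in> S" for p using p[OF that] m prime_gt_0_nat by simp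
  have "\<not> is_unit (cyc m)" using prime_elem_cyc[OF m] by auto
  then obtain R where R: "P = cyc m ^ i * R" "\<not> cyc m dvd R"
    using multiplicity_decompose'[OF P, of "cyc m"] unfolding i_def by metis
  \<comment> \<open>The prime \<open>f p\<close> does not divide \<open>cyc m\<close>, so its full
    power passes to the cofactor \<open>R\<close>.\<close>
  have "f p ^ j p dvd R" if "p \<in> S" for p
  proof (cases "j p = 0")
    case False
    have pr: "prime_elem (f p)" unfolding f_def by (rule prime_elem_cyc) (rule pos[OF that])
    have "m * p ^ e p \<noteq> m" using p[OF that] m prime_gt_1_nat[of p] by auto
    then have "\<not> f p dvd cyc m" unfolding f_def using cyc_dvd_cyc_iff[OF pos[OF that] m] by simp
    then have "\<not> f p dvd cyc m ^ i" using pr prime_elem_dvd_power by blast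
    moreover have "f p ^ j p dvd cyc m ^ i * R"
      unfolding R(1)[symmetric] f_def j_def by (rule multiplicity_dvd)
    ultimately show ?thesis using prime_power_dvd_multD[OF pr] False by blast
  qed simp
  moreover have "\<not> f p dvd f q" if "p \<in> S" "q \<in> S" "p \<noteq> q" for p q
  proof
    assume "f p dvd f q"
    then have "m * p ^ e p = m * q ^ e q"
      unfolding f_def using cyc_dvd_cyc_iff[OF pos[OF that(1)] pos[OF that(2)]] by simp
    then have "p dvd q ^ e q" using m p[OF that(1)] by (metis dvd_power mult_left_cancel not_gr_zero)
    then have "p dvd q" using p that prime_dvd_power by blast
    then show False using p that primes_dvd_imp_eq by blast
  qed
  ultimately have "(\<Prod>p\<in>S. f p ^ j p) dvd R"
    by (intro primes_power_prod_dvd S) (auto simp: f_def intro!: prime_elem_cyc pos)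
  then obtain H where H: "R = (\<Prod>p\<in>S. f p ^ j p) * H" by (auto elim: dvdE)
  have "\<forall>p\<in>S. \<exists>s. \<forall>z. primitive_root m z \<longrightarrow> ev (f p) z = of_nat p * ev s z"
    unfolding f_def using ev_cyc_mult_prime_power m p by blast
  then obtain s where s: "\<And>p z. p \<in> S \<Longrightarrow> primitive_root m z \<Longrightarrow> ev (f p) z = of_nat p * ev (s p) z"
    by metis
  define W where "W = smult (fact i) (pderiv (cyc m) ^ i * (\<Prod>p\<in>S. s p ^ j p) * H)"
  have T: "ev ((pderiv ^^ i) P) z = of_nat (\<Prod>p\<in>S. p ^ j p) * ev W z" if z: "primitive_root m z" for z
  proof -
    have "ev ((pderiv ^^ i) P) z = fact i * ev (pderiv (cyc m)) z ^ i * ev R z"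
      unfolding R(1) by (rule ev_higher_pderiv_power_mult) (rule ev_cyc_primitive_root[OF m z])
    also have "ev R z = (\<Prod>p\<in>S. ev (f p) z ^ j p) * ev H z"
      by (simp add: H ev_prod)
    also have "(\<Prod>p\<in>S. ev (f p) z ^ j p) = (\<Prod>p\<in>S. of_nat p ^ j p) * (\<Prod>p\<in>S. ev (s p) z ^ j p)"
      using s z by (simp add: power_mult_distrib prod.distrib)
    finally show ?thesis by (simp add: W_def ev_prod)
  qed
  note z = primitive_root_cis[OF m]
  have "ev R (cis (2 * pi / real m)) \<noteq> 0" using cyc_dvd_iff[OF m z] R(2) by simp
  moreover have "ev ((pderiv ^^ i) P) (cis (2 * pi / real m)) =
      fact i * ev (pderiv (cyc m)) (cis (2 * pi / real m)) ^ i * ev R (cis (2 * pi / real m))"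
    unfolding R(1) by (rule ev_higher_pderiv_power_mult) (rule ev_cyc_primitive_root[OF m z])
  ultimately have "ev ((pderiv ^^ i) P) (cis (2 * pi / real m)) \<noteq> 0"
    using ev_pderiv_cyc_ne_0[OF m z] by simp
  then have "ev W (cis (2 * pi / real m)) \<noteq> 0" using T[OF z] by auto
  then obtain w where w: "primitive_root m w" "norm (ev W w) \<ge> 1"
    using ex_conjugate_norm_ge_1[OF m z] by blast
  have "real (\<Prod>p\<in>S. p ^ j p) * 1 \<le> real (\<Prod>p\<in>S. p ^ j p) * norm (ev W w)"
    using w(2) by (intro mult_left_mono of_nat_0_le_iff)
  also have "\<dots> = norm (ev ((pderiv ^^ i) P) w)"
    unfolding T[OF w(1)] norm_mult by (simp only: norm_of_nat)
  also have "\<dots> \<le> poly_l1 ((pderiv ^^ i) P)"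
    by (rule norm_ev_le) (rule norm_primitive_root[OF w(1) m])
  also have "\<dots> \<le> real (degree P) ^ i * poly_l1 P" by (rule poly_l1_higher_pderiv_le)
  finally show ?thesis by (simp add: i_def j_def mult.commute)
qed

section \<open>Periods of tilings\<close>

lemma rep_count_conv: "rep_count A B n = (\<Sum>a\<in>set_mset A. count A a * B (n - a))"
proof -
  let ?S = "{a \<in> set_mset A. B (n - a) > 0}"
  have *: "{(a, b). a \<in># A \<and> b \<in> elements B \<and> n = a + b} = (\<lambda>a. (a, n - a)) ` ?S"
    by (auto simp: elements_def)
  have "rep_count A B n = (\<Sum>a\<in>?S. count A a * B (n - a))"
    unfolding rep_count_def * by (subst sum.reindex) (auto simp: inj_on_def)
  also have "\<dots> = (\<Sum>a\<in>set_mset A. count A a * B (n - a))"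
    by (rule sum.mono_neutral_left) auto
  finally show ?thesis .
qed

text \<open>Pigeonhole: \<open>B\<close> is bounded by \<open>t\<close>, so windows of length
  \<open>d\<close> take finitely many values and two of them agree. A window determines the entry
  after it and the entry before it, hence the agreement spreads in both directions.\<close>

lemma convolution_ex_period:
  fixes c B :: "int \<Rightarrow> nat"
  assumes S: "finite S" "S \<noteq> {}" and c: "\<And>a. a \<in> S \<Longrightarrow> c a > 0"
    and conv: "\<And>n. (\<Sum>a\<in>S. c a * B (n - a)) = t"
  shows "\<exists>N>0. \<forall>n. B (n + int N) = B n"
proof -
  define lo hi where "lo = Min S" and "hi = Max S"
  define d where "d = hi - lo"
  have lo: "lo \<in> S" "\<And>a. a \<in> S \<Longrightarrow> lo \<le> a" and hi: "hi \<in> S" "\<And>a. a \<in> S \<Longrightarrow> a \<le> hi"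
    using S by (auto simp: lo_def hi_def)
  have bound: "B x \<le> t" for x
  proof -
    have "c lo * B (x + lo - lo) \<le> (\<Sum>a\<in>S. c a * B (x + lo - a))"
      by (rule member_le_sum) (use lo S in auto)
    then have "c lo * B x \<le> t" using conv[of "x + lo"] by simp
    moreover have "B x \<le> c lo * B x" using c[OF lo(1)] by (cases "c lo") auto
    ultimately show ?thesis using le_trans by blast
  qed
  have remove: "c e * B (n - e) + (\<Sum>a\<in>S - {e}. c a * B (n - a)) = t" if "e \<in> S" for e n
    using conv[of n] sum.remove[OF S(1) that, of "\<lambda>a. c a * B (n - a)"] by simp
  \<comment> \<open>Solving the convolution identity for the term of \<open>lo\<close> expresses an
    entry by the \<open>d\<close> entries before it; \<open>backward\<close> does the same with
    \<open>hi\<close>.\<close>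
  have forward: "B (x + d) = B (y + d)" if eq: "\<And>i. i \<in> {0..<d} \<Longrightarrow> B (x + i) = B (y + i)" for x y
  proof -
    have "B (x + d + lo - a) = B (y + d + lo - a)" if "a \<in> S - {lo}" for a
      using eq[of "d + lo - a"] lo(2)[of a] hi(2)[of a] that by (auto simp: d_def algebra_simps)
    then have "(\<Sum>a\<in>S - {lo}. c a * B (x + d + lo - a)) = (\<Sum>a\<in>S - {lo}. c a * B (y + d + lo - a))"
      by (intro sum.cong) auto
    then have "c lo * B (x + d) = c lo * B (y + d)"
      using remove[OF lo(1), of "x + d + lo"] remove[OF lo(1), of "y + d + lo"] unfolding add_diff_cancel_right' by linarith
    then show ?thesis using c[OF lo(1)] by simp
  qed
  have backward: "B (x - 1) = B (y - 1)" if eq: "\<And>i. i \<in> {0..<d} \<Longrightarrow> B (x + i) = B (y + i)" for x y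
  proof -
    have "B (x - 1 + hi - a) = B (y - 1 + hi - a)" if "a \<in> S - {hi}" for a
      using eq[of "hi - a - 1"] lo(2)[of a] hi(2)[of a] that by (auto simp: d_def algebra_simps)
    then have "(\<Sum>a\<in>S - {hi}. c a * B (x - 1 + hi - a)) = (\<Sum>a\<in>S - {hi}. c a * B (y - 1 + hi - a))"
      by (intro sum.cong) auto
    then have "c hi * B (x - 1) = c hi * B (y - 1)"
      using remove[OF hi(1), of "x - 1 + hi"] remove[OF hi(1), of "y - 1 + hi"] unfolding add_diff_cancel_right' by linarith
    then show ?thesis using c[OF hi(1)] by simp
  qed
  define win where "win = (\<lambda>x. restrict (\<lambda>i. B (x + i)) {0..<d})"
  have "range win \<subseteq> {0..<d} \<rightarrow>\<^sub>E {..t}" using bound by (auto simp: win_def)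
  moreover have "finite ({0..<d} \<rightarrow>\<^sub>E {..t})" by (intro finite_PiE) auto
  ultimately have "finite (range win)" by (rule finite_subset)
  then have "\<not> inj win" using finite_imageD infinite_UNIV_int by blast
  then obtain u v where "win u = win v" "u \<noteq> v" by (auto simp: inj_def)
  then obtain u v where uv: "win u = win v" "u < v" by (metis linorder_neqE)
  have "\<forall>i\<in>{0..<d}. B (u + k + i) = B (v + k + i)" for k
  proof (induction k rule: int_induct[where k = 0])
    case base
    show ?case
    proof
      fix i assume "i \<in> {0..<d}"
      then show "B (u + 0 + i) = B (v + 0 + i)"
        using fun_cong[OF uv(1), of i] by (simp add: win_def)
    qed
  next
    case (step1 k)
    show ?case
    proof
      fix i assume i: "i \<in> {0..<d}"
      show "B (u + (k + 1) + i) = B (v + (k + 1) + i)"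
      proof (cases "i + 1 = d")
        case True
        then have *: "u + (k + 1) + i = u + k + d" "v + (k + 1) + i = v + k + d" by auto
        show ?thesis unfolding * by (rule forward) (use step1(2) in blast)
      next
        case False
        then show ?thesis using bspec[OF step1(2), of "i + 1"] i by (simp add: algebra_simps)
      qed
    qed
  next
    case (step2 k)
    show ?case
    proof
      fix i assume i: "i \<in> {0..<d}"
      show "B (u + (k - 1) + i) = B (v + (k - 1) + i)"
      proof (cases "i = 0")
        case True
        then show ?thesis using backward[of "u + k" "v + k"] step2 by (simp add: algebra_simps)
      next
        case False
        then show ?thesis using bspec[OF step2(2), of "i - 1"] i by (simp add: algebra_simps)
      qed
    qed
  qed
  \<comment> \<open>Using \<open>forward\<close> instead of an entry of the window also covers
    \<open>d = 0\<close>, where all windows are empty.\<close>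
  then have "B (u + k + d) = B (v + k + d)" for k by (intro forward) auto
  from this[of "n - u - d" for n] have "B (n + int (nat (v - u))) = B n" for n
    using uv by (simp add: algebra_simps)
  then show ?thesis using uv by (intro exI[of _ "nat (v - u)"]) auto
qed

section \<open>Discrete Fourier analysis on the integers modulo \<open>N\<close>\<close>

lemma sum_periodic_shift:
  fixes h :: "int \<Rightarrow> 'a :: comm_monoid_add"
  assumes "N > 0" "\<And>n. h (n + N) = h n"
  shows "(\<Sum>j\<in>{0..<N}. h (j + a)) = (\<Sum>j\<in>{0..<N}. h j)"
proof -
  have mult: "h (n + N * k) = h n" for n k
  proof (induction k rule: int_induct[where k = 0])
    case (step1 k)
    then show ?case using assms(2)[of "n + N * k"] by (simp add: algebra_simps)
  next
    case (step2 k)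
    then show ?case using assms(2)[of "n + N * (k - 1)"] by (simp add: algebra_simps)
  qed simp
  have md: "h (n mod N) = h n" for n
    using mult[of "n mod N" "n div N"] by (simp add: mult.commute)
  have "(\<Sum>j\<in>{0..<N}. h ((j + a) mod N)) = (\<Sum>j\<in>{0..<N}. h j)"
    by (rule sum.reindex_bij_witness[of _ "\<lambda>j. (j - a) mod N" "\<lambda>j. (j + a) mod N"])
       (use assms(1) in \<open>auto simp: mod_simps\<close>)
  then show ?thesis by (simp add: md)
qed

lemma sum_roots_of_unity_powi:
  fixes \<omega> :: complex
  assumes "N > 0" "\<omega> ^ N = 1" "\<omega> \<noteq> 1"
  shows "(\<Sum>j\<in>{0..<int N}. \<omega> powi j) = 0"
proof -
  have nz: "\<omega> \<noteq> 0" using assms by (auto simp: power_0_left)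
  have "(\<Sum>j\<in>{0..<int N}. \<omega> powi (j + 1)) = (\<Sum>j\<in>{0..<int N}. \<omega> powi j)"
    by (rule sum_periodic_shift) (use assms nz in \<open>auto simp: power_int_add\<close>)
  then have "\<omega> * (\<Sum>j\<in>{0..<int N}. \<omega> powi j) = (\<Sum>j\<in>{0..<int N}. \<omega> powi j)"
    using nz by (simp add: power_int_add sum_distrib_left mult.commute)
  then show ?thesis using assms(3) by simp
qed

lemma sum_over_roots_of_unity:
  assumes "N > 0" "j \<in> {0..<int N}"
  shows "(\<Sum>\<omega>\<in>{\<omega> :: complex. \<omega> ^ N = 1}. \<omega> powi j) = (if j = 0 then of_nat N else 0)"
proof (cases "j = 0")
  case True
  then show ?thesis using card_roots_unity_eq[of N] assms by simp
next
  case False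
  define \<zeta> where "\<zeta> = cis (2 * pi / real N)"
  have \<zeta>: "primitive_root N \<zeta>" unfolding \<zeta>_def by (rule primitive_root_cis) fact
  have nz: "\<zeta> \<noteq> 0" using \<zeta> assms(1) by (rule primitive_root_ne_0)
  have \<zeta>N: "\<zeta> ^ N = 1" using \<zeta> by (rule primitive_root_power_eq_1)
  have "\<zeta> powi j = \<zeta> ^ nat j" using assms by (simp add: power_int_def)
  moreover have "\<not> N dvd nat j" using assms False by (auto dest: dvd_imp_le)
  ultimately have ne: "\<zeta> powi j \<noteq> 1" using \<zeta> by (simp add: primitive_root_def)
  have "(\<Sum>\<omega>\<in>{\<omega>. \<omega> ^ N = 1}. (\<zeta> * \<omega>) powi j) = (\<Sum>\<omega>\<in>{\<omega>. \<omega> ^ N = 1}. \<omega> powi j)"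
    by (rule sum.reindex_bij_witness[of _ "\<lambda>\<omega>. \<omega> / \<zeta>" "\<lambda>\<omega>. \<zeta> * \<omega>"])
       (use nz \<zeta>N in \<open>auto simp: power_mult_distrib power_divide\<close>)
  then have "\<zeta> powi j * (\<Sum>\<omega>\<in>{\<omega>. \<omega> ^ N = 1}. \<omega> powi j) = (\<Sum>\<omega>\<in>{\<omega>. \<omega> ^ N = 1}. \<omega> powi j)"
    by (simp add: power_int_mult_distrib sum_distrib_left)
  then show ?thesis using ne False by simp
qed

text \<open>Fourier inversion: \<open>f\<close> is a combination of characters, and by assumption
  each character with nonzero coefficient has period \<open>k\<close>.\<close>

lemma periodic_from_spectrum:
  fixes f :: "int \<Rightarrow> complex"
  assumes N: "N > 0" "\<And>n. f (n + int N) = f n"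
    and k: "\<And>\<omega>. \<omega> ^ N = 1 \<Longrightarrow> (\<Sum>j\<in>{0..<int N}. f j * \<omega> powi j) \<noteq> 0 \<Longrightarrow> \<omega> ^ k = 1"
  shows "f (n + int k) = f n"
proof -
  define C where "C = (\<lambda>\<omega>. \<Sum>j\<in>{0..<int N}. f j * \<omega> powi j)"
  have inv: "of_nat N * f n = (\<Sum>\<omega>\<in>{\<omega>. \<omega> ^ N = 1}. \<omega> powi (- n) * C \<omega>)" for n
  proof -
    have "(\<Sum>\<omega>\<in>{\<omega>. \<omega> ^ N = 1}. \<omega> powi (- n) * C \<omega>) =
        (\<Sum>\<omega>\<in>{\<omega>. \<omega> ^ N = 1}. \<Sum>j\<in>{0..<int N}. f (j + n) * \<omega> powi j)"
    proof (rule sum.cong)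
      fix \<omega> :: complex assume "\<omega> \<in> {\<omega>. \<omega> ^ N = 1}"
      then have \<omega>: "\<omega> ^ N = 1" by simp
      then have nz: "\<omega> \<noteq> 0" using N(1) by (auto simp: power_0_left)
      have "(\<Sum>j\<in>{0..<int N}. f (j + n) * \<omega> powi (j + n)) = C \<omega>"
        unfolding C_def
        by (rule sum_periodic_shift[where h = "\<lambda>j. f j * \<omega> powi j"])
           (use N nz \<omega> in \<open>auto simp: power_int_add\<close>)
      then have "\<omega> powi (- n) * C \<omega> =
          (\<Sum>j\<in>{0..<int N}. \<omega> powi (- n) * (f (j + n) * \<omega> powi (j + n)))"
        by (simp only: sum_distrib_left[symmetric])
      also have "\<dots> = (\<Sum>j\<in>{0..<int N}. f (j + n) * \<omega> powi j)"
        using nz by (intro sum.cong) (auto simp: power_int_add power_int_minus)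
      finally show "\<omega> powi (- n) * C \<omega> = (\<Sum>j\<in>{0..<int N}. f (j + n) * \<omega> powi j)" .
    qed simp
    also have "\<dots> = (\<Sum>j\<in>{0..<int N}. f (j + n) * (\<Sum>\<omega>\<in>{\<omega>. \<omega> ^ N = 1}. \<omega> powi j))"
      by (subst sum.swap) (simp add: sum_distrib_left)
    also have "\<dots> = (\<Sum>j\<in>{0..<int N}. if j = 0 then f n * of_nat N else 0)"
      by (intro sum.cong) (auto simp: sum_over_roots_of_unity[OF N(1)])
    also have "\<dots> = f n * of_nat N" using N(1) by simp
    finally show ?thesis by (simp add: mult.commute)
  qed
  have "of_nat N * f (n + int k) = of_nat N * f n"
    unfolding inv
  proof (rule sum.cong)
    fix \<omega> :: complex assume "\<omega> \<in> {\<omega>. \<omega> ^ N = 1}"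
    then have \<omega>: "\<omega> ^ N = 1" by simp
    then have nz: "\<omega> \<noteq> 0" using N(1) by (auto simp: power_0_left)
    show "\<omega> powi (- (n + int k)) * C \<omega> = \<omega> powi (- n) * C \<omega>"
    proof (cases "C \<omega> = 0")
      case False
      then have "\<omega> ^ k = 1" using k[OF \<omega>] by (simp add: C_def)
      then show ?thesis using nz by (simp add: power_int_add power_int_minus power_int_diff)
    qed simp
  qed simp
  then show ?thesis using N(1) by simp
qed

section \<open>The mask polynomial and the period of a tiling\<close>

text \<open>The shift by the minimum makes the exponents nonnegative and the constant coefficient
  nonzero; at a root of unity it only costs a power of that root.\<close>

definition mask_poly :: "int multiset \<Rightarrow> int poly" where
  "mask_poly A = (\<Sum>a\<in>set_mset A. monom (int (count A a)) (nat (a - Min (set_mset A))))"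

context
  fixes A :: "int multiset"
  assumes A: "A \<noteq> {#}"
begin

lemma coeff_mask_poly: "coeff (mask_poly A) k = int (count A (Min (set_mset A) + int k))"
proof -
  let ?lo = "Min (set_mset A)"
  have lo: "?lo \<le> a" if "a \<in># A" for a using that by simp
  have "coeff (mask_poly A) k = (\<Sum>a\<in>set_mset A. if a = ?lo + int k then int (count A a) else 0)"
    unfolding mask_poly_def coeff_sum using lo by (intro sum.cong) auto
  then show ?thesis by (simp add: count_eq_zero_iff)
qed

lemma degree_mask_poly: "degree (mask_poly A) = nat (diam A)"
proof (rule antisym)
  let ?S = "set_mset A"
  have ne: "?S \<noteq> {}" using A by simp
  show "degree (mask_poly A) \<le> nat (diam A)"
  proof (rule degree_le, intro allI impI)
    fix k assume "k > nat (diam A)"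
    then have "Max ?S < Min ?S + int k" by (auto simp: diam_def)
    then have "Min ?S + int k \<notin> ?S" using Max_ge[of ?S] by fastforce
    then show "coeff (mask_poly A) k = 0" by (simp add: coeff_mask_poly not_in_iff)
  qed
  have "Min ?S \<le> Max ?S" using ne by simp
  then have "Min ?S + int (nat (diam A)) = Max ?S" by (simp add: diam_def)
  then show "nat (diam A) \<le> degree (mask_poly A)"
    using Max_in[of ?S] ne by (intro le_degree) (simp add: coeff_mask_poly)
qed

lemma mask_poly_ne_0: "mask_poly A \<noteq> 0"
proof -
  have "Min (set_mset A) \<in># A" using Min_in[of "set_mset A"] A by simp
  then have "coeff (mask_poly A) 0 \<noteq> 0" by (simp add: coeff_mask_poly)
  then show ?thesis by auto
qed

lemma poly_l1_mask_poly: "poly_l1 (mask_poly A) = real (\<Sum>a\<in>set_mset A. count A a)"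
proof -
  let ?S = "set_mset A"
  have "poly_l1 (mask_poly A) = (\<Sum>k\<le>nat (diam A). real (count A (Min ?S + int k)))"
    by (simp add: poly_l1_def degree_mask_poly coeff_mask_poly)
  also have "\<dots> = (\<Sum>a\<in>(\<lambda>k. Min ?S + int k) ` {..nat (diam A)}. real (count A a))"
    by (subst sum.reindex) (auto simp: inj_on_def)
  also have "\<dots> = (\<Sum>a\<in>?S. real (count A a))"
  proof (rule sum.mono_neutral_right)
    show "?S \<subseteq> (\<lambda>k. Min ?S + int k) ` {..nat (diam A)}"
    proof
      fix a assume "a \<in> ?S"
      then have "Min ?S \<le> a" "a \<le> Max ?S" by auto
      then show "a \<in> (\<lambda>k. Min ?S + int k) ` {..nat (diam A)}"
        by (intro image_eqI[of _ _ "nat (a - Min ?S)"]) (auto simp: diam_def)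
    qed
  qed (auto simp: not_in_iff)
  finally show ?thesis by simp
qed

lemma ev_mask_poly: 
  "ev (mask_poly A) w = (\<Sum>a\<in>set_mset A. of_nat (count A a) * w ^ nat (a - Min (set_mset A)))"
proof -
  have "ev (\<Sum>i\<in>I. f i) w = (\<Sum>i\<in>I. ev (f i) w)" for I :: "int set" and f
    by (induction I rule: infinite_finite_induct) simp_all
  then show ?thesis by (simp add: mask_poly_def)
qed

text \<open>The value at 1 is the total weight of \<open>A\<close>, which is positive. This starts
  the induction that bounds all multiplicities.\<close>

lemma multiplicity_cyc_1_mask_poly: "multiplicity (cyc 1) (mask_poly A) = 0"
proof (rule not_dvd_imp_multiplicity_0)
  have "ev (mask_poly A) 1 = of_nat (\<Sum>a\<in>set_mset A. count A a)"
    by (simp add: ev_mask_poly)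
  moreover have "(\<Sum>a\<in>set_mset A. count A a) \<noteq> 0" using A by auto
  ultimately have "ev (mask_poly A) 1 \<noteq> 0" by (metis of_nat_eq_0_iff)
  then show "\<not> cyc 1 dvd mask_poly A"
    using cyc_dvd_iff[of 1 1 "mask_poly A"] primitive_root_1_iff by simp
qed

text \<open>The a priori period \<open>N\<close> may be huge and only makes Fourier analysis
  available. If the coefficient of \<open>B\<close> at a root of unity other than 1 is nonzero, then
  the mask polynomial vanishes there, so the order of this root lies in \<open>D\<close>.\<close>

lemma tiling_period:
  assumes tiling: "is_tiling t A B"
  shows "\<exists>D. finite D \<and> (\<forall>d\<in>D. d > 0 \<and> cyc d dvd mask_poly A) \<and> periodic_with B (int (Lcm D))"
proof -
  let ?S = "set_mset A" and ?lo = "Min (set_mset A)"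
  have conv: "(\<Sum>a\<in>?S. count A a * B (n - a)) = t" for n
    using tiling by (simp add: is_tiling_def rep_count_conv)
  obtain N where N: "N > 0" "\<And>n. B (n + int N) = B n"
    using convolution_ex_period[of ?S "count A" B t] conv A by auto
  define D where "D = {d. d dvd N \<and> cyc d dvd mask_poly A}"
  have D: "finite D" "\<forall>d\<in>D. d > 0 \<and> cyc d dvd mask_poly A"
    using N(1) unfolding D_def by (auto intro: dvd_pos_nat)
  define k where "k = Lcm D"
  have "k \<noteq> 0" unfolding k_def using D by (auto simp: Lcm_0_iff)
  define f :: "int \<Rightarrow> complex" where "f = (\<lambda>n. of_nat (B n))"
  have "f (n + int k) = f n" for n
  proof (rule periodic_from_spectrum[OF N(1)])
    show "f (n + int N) = f n" for n by (simp add: f_def N(2))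
    fix \<omega> assume \<omega>: "\<omega> ^ N = 1" and C: "(\<Sum>j\<in>{0..<int N}. f j * \<omega> powi j) \<noteq> 0"
    have nz: "\<omega> \<noteq> 0" using \<omega> N(1) by (auto simp: power_0_left)
    show "\<omega> ^ k = 1"
    proof (cases "\<omega> = 1")
      case False
      \<comment> \<open>Away from 1 the transform of the constant \<open>t\<close> vanishes; the
        transform of the convolution is a product with the mask polynomial.\<close>
      have "0 = (\<Sum>j\<in>{0..<int N}. of_nat t * \<omega> powi j)"
        using sum_roots_of_unity_powi[OF N(1) \<omega> False] by (simp flip: sum_distrib_left)
      also have "\<dots> = (\<Sum>j\<in>{0..<int N}. \<Sum>a\<in>?S. of_nat (count A a) * (f (j - a) * \<omega> powi j))"
      proof (rule sum.cong)
        fix j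
        have "of_nat t = (\<Sum>a\<in>?S. of_nat (count A a) * f (j - a))"
          using arg_cong[OF conv[of j], of "of_nat :: nat \<Rightarrow> complex"] by (simp add: f_def)
        then show "of_nat t * \<omega> powi j = (\<Sum>a\<in>?S. of_nat (count A a) * (f (j - a) * \<omega> powi j))"
          by (simp add: sum_distrib_right mult.assoc)
      qed simp
      also have "\<dots> = (\<Sum>a\<in>?S. of_nat (count A a) * (\<Sum>j\<in>{0..<int N}. f (j - a) * \<omega> powi j))"
        by (subst sum.swap) (simp add: sum_distrib_left)
      also have "\<dots> = (\<Sum>a\<in>?S. of_nat (count A a) * (\<omega> powi a * (\<Sum>j\<in>{0..<int N}. f j * \<omega> powi j)))"
      proof (rule sum.cong)
        fix a assume "a \<in> ?S"
        have "(\<Sum>j\<in>{0..<int N}. f (j - a) * \<omega> powi j) =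
            (\<Sum>j\<in>{0..<int N}. \<omega> powi a * (f (j + (- a)) * \<omega> powi (j + (- a))))"
          using nz by (intro sum.cong) (auto simp: power_int_diff)
        also have "\<dots> = \<omega> powi a * (\<Sum>j\<in>{0..<int N}. f (j + (- a)) * \<omega> powi (j + (- a)))"
          by (simp only: sum_distrib_left)
        also have "(\<Sum>j\<in>{0..<int N}. f (j + (- a)) * \<omega> powi (j + (- a))) =
            (\<Sum>j\<in>{0..<int N}. f j * \<omega> powi j)"
          by (rule sum_periodic_shift[where h = "\<lambda>j. f j * \<omega> powi j"])
             (use N \<omega> nz in \<open>auto simp: power_int_add f_def\<close>)
        finally show "of_nat (count A a) * (\<Sum>j\<in>{0..<int N}. f (j - a) * \<omega> powi j) =
            of_nat (count A a) * (\<omega> powi a * (\<Sum>j\<in>{0..<int N}. f j * \<omega> powi j))" by simp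
      qed simp
      also have "\<dots> = (\<Sum>a\<in>?S. of_nat (count A a) * \<omega> powi a) * (\<Sum>j\<in>{0..<int N}. f j * \<omega> powi j)"
        by (simp add: sum_distrib_right mult.assoc)
      also have "(\<Sum>a\<in>?S. of_nat (count A a) * \<omega> powi a) = \<omega> powi ?lo * ev (mask_poly A) \<omega>"
        unfolding ev_mask_poly sum_distrib_left
      proof (rule sum.cong)
        fix a assume "a \<in> ?S"
        then have "\<omega> powi (a - ?lo) = \<omega> ^ nat (a - ?lo)" by (simp add: power_int_def)
        moreover have "\<omega> powi a = \<omega> powi ?lo * \<omega> powi (a - ?lo)"
          using nz by (simp flip: power_int_add)
        ultimately show "of_nat (count A a) * \<omega> powi a =
            \<omega> powi ?lo * (of_nat (count A a) * \<omega> ^ nat (a - ?lo))" by simp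
      qed simp
      finally have "ev (mask_poly A) \<omega> = 0" using C nz by simp
      moreover obtain d where d: "d > 0" "d dvd N" "primitive_root d \<omega>"
        using root_of_unity_primitive[OF N(1) \<omega>] by blast
      ultimately have "d \<in> D" using cyc_dvd_iff[OF d(1,3)] by (simp add: D_def)
      then have "d dvd k" unfolding k_def by (rule dvd_Lcm)
      then show ?thesis using d(3) by (simp add: primitive_root_def)
    qed simp
  qed
  then have "periodic_with B (int k)"
    using \<open>k \<noteq> 0\<close> by (simp add: periodic_with_def f_def)
  then show ?thesis using D k_def by blast
qed

end

section \<open>Counting prime factors\<close>

abbreviation omega :: "nat \<Rightarrow> nat" where
  "omega m \<equiv> card (prime_factors m)"

lemma prime_power_mult_induct [consumes 1, case_names one step]:
  fixes m :: nat
  assumes "m > 0" and "P 1"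
    and step: "\<And>m p a. m > 0 \<Longrightarrow> prime p \<Longrightarrow> \<not> p dvd m \<Longrightarrow> a > 0 \<Longrightarrow> P m \<Longrightarrow> P (m * p ^ a)"
  shows "P m"
  using assms(1)
proof (induction m rule: less_induct)
  case (less m)
  show ?case
  proof (cases "m = 1")
    case False
    then obtain p where p: "prime p" "p dvd m" by (meson prime_factor_nat)
    define a where "a = multiplicity p m"
    have "\<not> is_unit p" using p(1) not_prime_unit by blast
    then obtain m' where m': "m = p ^ a * m'" "\<not> p dvd m'"
      using multiplicity_decompose'[of m p] less.prems unfolding a_def by blast
    have a: "a > 0" using p m' by (cases a) auto
    have "m' > 0" using less.prems m' by (cases m') auto
    moreover have "p ^ a > 1" using p a prime_gt_1_nat one_less_power by blast
    then have "m' < m" using \<open>m' > 0\<close> unfolding m'(1) by simp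
    ultimately have "P (m' * p ^ a)" using p a m' less.IH by (intro step) auto
    then show ?thesis using m'(1) by (simp add: mult.commute)
  qed (use assms in simp)
qed

lemma prime_factors_mult_prime_power:
  fixes m p :: nat
  assumes "m > 0" "prime p" "\<not> p dvd m" "a > 0"
  shows "prime_factors (m * p ^ a) = insert p (prime_factors m)" "p \<notin> prime_factors m"
    "omega (m * p ^ a) = Suc (omega m)"
proof -
  have "p ^ a \<noteq> 0" using assms(2) by (auto simp: prime_gt_0_nat)
  then show *: "prime_factors (m * p ^ a) = insert p (prime_factors m)"
    using assms by (simp add: prime_factors_product prime_factors_power prime_prime_factors)
  show **: "p \<notin> prime_factors m" using assms(3) by auto
  show "omega (m * p ^ a) = Suc (omega m)" unfolding * using ** by simp
qed

section \<open>Bounds for the number of prime factors and for the totient\<close>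

lemma power_card_prime_factors_le:
  assumes "m > 0" "T \<subseteq> prime_factors m" "\<And>p. p \<in> T \<Longrightarrow> Y \<le> real p" "Y \<ge> 0"
  shows "Y ^ card T \<le> real m"
proof -
  have "(\<Prod>p\<in>T. p) dvd (\<Prod>p\<in>T. p ^ multiplicity p m)"
    using assms(2) by (intro prod_dvd_prod) (auto simp: prime_factors_multiplicity intro!: dvd_power)
  also have "\<dots> dvd (\<Prod>p\<in>prime_factors m. p ^ multiplicity p m)"
    using assms(2) by (intro prod_dvd_prod_subset) auto
  also have "\<dots> = m" using assms(1) by (simp add: prod_prime_factors)
  finally have le: "(\<Prod>p\<in>T. p) \<le> m" using assms(1) by (intro dvd_imp_le)
  have "Y ^ card T = (\<Prod>p\<in>T. Y)" by simp
  also have "\<dots> \<le> (\<Prod>p\<in>T. real p)" using assms by (intro prod_mono) auto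
  also have "\<dots> \<le> real m" using le by (simp flip: of_nat_prod)
  finally show ?thesis .
qed

lemma two_power_omega_le: "m > 0 \<Longrightarrow> 2 ^ omega m \<le> real m"
  by (rule power_card_prime_factors_le) (auto dest!: in_prime_factors_imp_prime prime_ge_2_nat)

text \<open>At most \<open>Y\<close> prime factors are up to \<open>Y\<close>; the remaining ones
  all exceed \<open>Y\<close>, and their product is at most \<open>m\<close>.\<close>

lemma omega_le:
  assumes "m > 0" "Y > 1"
  shows "real (omega m) \<le> Y + ln (real m) / ln Y"
proof -
  define T where "T = {p \<in> prime_factors m. real p > Y}"
  define U where "U = {p \<in> prime_factors m. real p \<le> Y}"
  have "prime_factors m = U \<union> T" "U \<inter> T = {}" by (auto simp: T_def U_def)
  then have om: "omega m = card U + card T"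
    by (metis card_Un_disjoint finite_Un finite_set_mset)
  have "U \<subseteq> {1..nat \<lfloor>Y\<rfloor>}"
  proof
    fix p assume "p \<in> U"
    then have "prime p" "real p \<le> Y" by (auto simp: U_def)
    then show "p \<in> {1..nat \<lfloor>Y\<rfloor>}" using prime_ge_1_nat by (auto simp: le_nat_floor)
  qed
  then have "card U \<le> nat \<lfloor>Y\<rfloor>" using card_mono[of "{1..nat \<lfloor>Y\<rfloor>}" U] by simp
  then have U: "real (card U) \<le> Y" using assms(2) by linarith
  have "Y ^ card T \<le> real m"
    using assms by (intro power_card_prime_factors_le) (auto simp: T_def)
  then have "ln (Y ^ card T) \<le> ln (real m)" using assms by (subst ln_le_cancel_iff) auto
  then have "real (card T) * ln Y \<le> ln (real m)" using assms by (simp add: ln_realpow)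
  then have "real (card T) \<le> ln (real m) / ln Y" using assms by (simp add: pos_le_divide_eq)
  with U om show ?thesis by simp
qed

text \<open>The extremal set consists of the integers from 2 to \<open>card S + 1\<close>, for which
  the product telescopes. Accordingly a new maximum \<open>b\<close> is at least
  \<open>card A + 2\<close>.\<close>

lemma prod_one_minus_inverse_ge:
  fixes S :: "nat set"
  assumes "finite S" "S \<subseteq> {2..}"
  shows "(\<Prod>p\<in>S. 1 - 1 / real p) \<ge> 1 / (1 + real (card S))"
  using assms
proof (induction S rule: finite_linorder_max_induct)
  case (insert b A)
  have "A \<subseteq> {2..<b}" using insert by auto
  then have "card A \<le> b - 2" using card_mono[of "{2..<b}" A] by simp
  then have b: "real (card A) + 2 \<le> real b" using insert by auto
  have nb: "b \<notin> A" using insert by auto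
  have "1 / (2 + real (card A)) = 1 / (1 + real (card A)) * (1 - 1 / (2 + real (card A)))"
    by (simp add: field_simps)
  also have "\<dots> \<le> (\<Prod>p\<in>A. 1 - 1 / real p) * (1 - 1 / real b)"
    using insert b by (intro mult_mono) (auto simp: frac_le field_simps intro!: prod_nonneg)
  finally show ?case using nb insert(1) by (simp add: mult.commute)
qed simp

lemma le_totient_mult:
  assumes "d > 0"
  shows "real d \<le> real (totient d) * (1 + real (omega d))"
proof -
  have "1 / (1 + real (omega d)) \<le> (\<Prod>p\<in>prime_factors d. 1 - 1 / real p)"
    by (rule prod_one_minus_inverse_ge) (auto dest: in_prime_factors_imp_prime prime_ge_2_nat)
  then have "real d * (1 / (1 + real (omega d))) \<le> real (totient d)"
    unfolding totient_formula2 by (intro mult_left_mono) auto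
  then show ?thesis by (simp add: field_simps)
qed

lemma omega_le_log2:
  assumes "d > 0"
  shows "real (omega d) \<le> ln (real d) / ln 2"
proof -
  have "ln (2 ^ omega d) \<le> ln (real d)" 
    using two_power_omega_le[OF assms] assms by (subst ln_le_cancel_iff) auto
  then show ?thesis by (simp add: ln_realpow field_simps)
qed

lemma ln_2_ge_half: "1 / 2 \<le> ln (2 :: real)"
  using ln_le_minus_one[of "1 / 2 :: real"] by (simp add: ln_div)

text \<open>Crude, but it bounds \<open>d\<close> by a power of \<open>totient d\<close>, and only
  the logarithm of \<open>d\<close> matters later. From \<open>ln 2 \<ge> 1 / 2\<close> follows
  \<open>1 + omega d \<le> 4 * sqrt d\<close>, and the constant is the square of 4.\<close>

lemma le_totient_square:
  assumes "d > 0"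
  shows "real d \<le> 16 * real (totient d) ^ 2"
proof -
  let ?r = "sqrt (real d)"
  have r: "?r \<ge> 1" using assms by simp
  have "ln (real d) = 2 * ln ?r" using assms by (simp add: ln_sqrt)
  also have "\<dots> \<le> 2 * (?r - 1)" using ln_le_minus_one[of ?r] r by simp
  finally have l: "ln (real d) \<le> 2 * (?r - 1)" .
  have "ln (real d) / ln 2 \<le> 2 * (?r - 1) / (1 / 2)"
    using ln_2_ge_half l assms r by (intro frac_le) auto
  then have "1 + real (omega d) \<le> 4 * ?r" using omega_le_log2[OF assms] by argo
  then have "real (totient d) * (1 + real (omega d)) \<le> real (totient d) * (4 * ?r)"
    by (intro mult_left_mono) auto
  then have "?r * ?r \<le> 4 * real (totient d) * ?r" using le_totient_mult[OF assms] by simp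
  then have "?r \<le> 4 * real (totient d)" using r by (subst (asm) mult_le_cancel_right) auto
  then have "?r ^ 2 \<le> (4 * real (totient d)) ^ 2" using r by (intro power_mono) auto
  then show ?thesis by (simp add: power_mult_distrib)
qed

lemma card_square_le_sum:
  fixes S :: "nat set"
  assumes "finite S" "0 \<notin> S"
  shows "card S ^ 2 \<le> 2 * \<Sum>S"
  using assms
proof (induction S rule: finite_linorder_max_induct)
  case (insert b A)
  have "A \<subseteq> {1..<b}" using insert by (auto simp: Suc_le_eq intro: gr0I)
  then have "card A \<le> b - 1" using card_mono[of "{1..<b}" A] by simp
  then have b: "card A + 1 \<le> b" using insert by (cases b) auto
  have "b \<notin> A" using insert by auto
  then show ?case using insert b by (simp add: power2_eq_square)
qed simp

section \<open>Mean values of powers with exponent \<open>omega m\<close>\<close>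

text \<open>Over the squarefree divisors alone there would be equality, by the binomial theorem. In
  the induction, the divisors of \<open>m\<close> and their multiples by \<open>p\<close> are
  disjoint sets of divisors of \<open>m * p ^ a\<close>.\<close>

lemma power_omega_le_divisor_sum:
  fixes z :: nat
  assumes "m > 0"
  shows "(z + 1) ^ omega m \<le> (\<Sum>d | d dvd m. z ^ omega d)"
  using assms
proof (induction m rule: prime_power_mult_induct)
  case (step m p a)
  let ?D = "{d. d dvd m}"
  have fin: "finite ?D" using step by simp
  have p0: "p > 0" using step prime_gt_0_nat by simp
  have om: "omega (d * p) = Suc (omega d)" if "d \<in> ?D" for d
  proof -
    have "d > 0" "\<not> p dvd d" using that step(1,3) by (auto intro: dvd_pos_nat dvd_trans)
    then show ?thesis using prime_factors_mult_prime_power(3)[of d p 1] step(2) by simp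
  qed
  have inj: "inj_on (\<lambda>d. d * p) ?D" using p0 by (auto simp: inj_on_def)
  have disj: "?D \<inter> (\<lambda>d. d * p) ` ?D = {}" using step(3) by (auto dest: dvd_mult_right)
  have "(z + 1) ^ omega (m * p ^ a) = (z + 1) * (z + 1) ^ omega m"
    using prime_factors_mult_prime_power(3)[of m p a] step by simp
  also have "\<dots> \<le> (z + 1) * (\<Sum>d\<in>?D. z ^ omega d)" using step(5) by (intro mult_left_mono) auto
  also have "\<dots> = (\<Sum>d\<in>?D. z ^ omega d) + (\<Sum>d\<in>?D. z ^ omega (d * p))"
    using om by (simp add: distrib_right sum_distrib_left sum.distrib)
  also have "(\<Sum>d\<in>?D. z ^ omega (d * p)) = (\<Sum>d\<in>(\<lambda>d. d * p) ` ?D. z ^ omega d)"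
    by (simp add: sum.reindex[OF inj])
  also have "(\<Sum>d\<in>?D. z ^ omega d) + \<dots> = (\<Sum>d\<in>?D \<union> (\<lambda>d. d * p) ` ?D. z ^ omega d)"
    using fin disj by (subst sum.union_disjoint) auto
  also have "\<dots> \<le> (\<Sum>d | d dvd m * p ^ a. z ^ omega d)"
    using step(1,4) p0 by (intro sum_mono2) (auto intro!: mult_dvd_mono dvd_power)
  finally show ?case .
qed simp

text \<open>Each increment of \<open>z\<close> turns the sum into one over factorizations
  \<open>m = d * j\<close>. Dropping the constraint \<open>d * j \<le> n\<close> lets it split off
  one harmonic factor.\<close>

lemma sum_power_omega_div_le:
  "(\<Sum>m=1..n. real (z ^ omega m) / real m) \<le> (\<Sum>j=1..n. 1 / real j) ^ z"
proof (induction z)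
  case 0
  \<comment> \<open>Since \<open>0 ^ 0 = 1\<close>, the term \<open>m = 1\<close> survives, and it
    is the only one.\<close>
  have "(\<Sum>m=1..n. real (0 ^ omega m) / real m) \<le> (\<Sum>m=1..n. if m = 1 then 1 else 0)"
  proof (rule sum_mono)
    fix m assume m: "m \<in> {1..n}"
    show "real (0 ^ omega m) / real m \<le> (if m = 1 then 1 else 0)"
    proof (cases "m = 1")
      case False
      then obtain p where "prime p" "p dvd m" by (meson prime_factor_nat)
      then have "p \<in> prime_factors m" using m by (auto simp: prime_factors_dvd)
      then have "omega m \<noteq> 0" by (metis card_0_eq empty_iff finite_set_mset)
      then have "(0 :: nat) ^ omega m = 0" by (simp only: zero_power neq0_conv)
      then show ?thesis using False by (simp only: of_nat_0 div_0 if_False order_refl)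
    qed simp
  qed
  also have "\<dots> \<le> 1" by simp
  finally show ?case by simp
next
  case (Suc z)
  let ?H = "\<Sum>j=1..n. 1 / real j"
  let ?I = "SIGMA m:{1..n}. {d. d dvd m}"
  have fin: "finite {d. d dvd m}" if "m \<in> {1..n}" for m using that by simp
  have inj: "inj_on (\<lambda>(m, d). (d, m div d)) ?I"
    by (auto simp: inj_on_def elim!: dvdE)
  have "(\<Sum>m=1..n. real (Suc z ^ omega m) / real m) \<le>
      (\<Sum>m=1..n. \<Sum>d | d dvd m. real (z ^ omega d) / real m)"
  proof (rule sum_mono)
    fix m assume "m \<in> {1..n}"
    then have "Suc z ^ omega m \<le> (\<Sum>d | d dvd m. z ^ omega d)"
      using power_omega_le_divisor_sum[of m z] by simp
    then have "real (Suc z ^ omega m) \<le> (\<Sum>d | d dvd m. real (z ^ omega d))"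
      by (metis of_nat_le_iff of_nat_sum)
    then show "real (Suc z ^ omega m) / real m \<le> (\<Sum>d | d dvd m. real (z ^ omega d) / real m)"
      unfolding sum_divide_distrib[symmetric] by (intro divide_right_mono) auto
  qed
  also have "\<dots> = (\<Sum>(m, d)\<in>?I. real (z ^ omega d) / real m)"
    using fin by (subst sum.Sigma) auto
  also have "\<dots> = (\<Sum>(d, j)\<in>(\<lambda>(m, d). (d, m div d)) ` ?I. real (z ^ omega d) / (real d * real j))"
    unfolding sum.reindex[OF inj]
    by (intro sum.cong) (auto elim!: dvdE)
  also have "\<dots> \<le> (\<Sum>(d, j)\<in>{1..n} \<times> {1..n}. real (z ^ omega d) / (real d * real j))"
  proof (rule sum_mono2)
    show "(\<lambda>(m, d). (d, m div d)) ` ?I \<subseteq> {1..n} \<times> {1..n}"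
    proof safe
      fix m d assume m: "m \<in> {1..n}" and d: "d dvd m"
      then have "d > 0" "d \<le> m" by (auto intro: dvd_imp_le dvd_pos_nat)
      then show "d \<in> {1..n}" "m div d \<in> {1..n}"
        using m by (auto simp: Suc_le_eq div_greater_zero_iff intro: order_trans[OF div_le_dividend])
    qed
  qed auto
  also have "\<dots> = (\<Sum>d=1..n. real (z ^ omega d) / real d) * ?H"
    unfolding sum_product sum.cartesian_product by (intro sum.cong) auto
  also have "\<dots> \<le> ?H ^ z * ?H" by (intro mult_right_mono Suc.IH sum_nonneg) auto
  finally show ?case by (simp add: mult.commute)
qed

lemma harmonic_sum_le: "n > 0 \<Longrightarrow> (\<Sum>j=1..n. 1 / real j) \<le> 1 + ln (real n)"
proof (induction n rule: nat_induct_non_zero)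
  case (Suc n)
  have "ln (real n / real (Suc n)) \<le> real n / real (Suc n) - 1"
    using Suc by (intro ln_le_minus_one) auto
  moreover have "ln (real n / real (Suc n)) = ln (real n) - ln (real (Suc n))"
    using Suc by (subst ln_div) auto
  moreover have "real n / real (Suc n) - 1 = - (1 / real (Suc n))" by (simp add: field_simps)
  ultimately show ?case using Suc by simp
qed simp

text \<open>
  Writing \<open>K = (K / z) z\<close> pays off for \<open>z\<close> slightly smaller than \<open>K\<close>: powers of an integer \<open>z\<close> are
  controlled on average over \<open>m\<close>, and \<open>K / z\<close> is so small that a pointwise bound \<open>W\<close> is enough.
\<close>

lemma sum_powr_omega_le:
  fixes K W :: real
  assumes n: "n > 0" and z: "z > 0" "real z \<le> K" and W: "\<And>m. m \<in> {1..n} \<Longrightarrow> real (omega m) \<le> W"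
  shows "(\<Sum>m=1..n. K ^ omega m) \<le> (K / real z) powr W * real n * (1 + ln (real n)) ^ z"
proof -
  have Kz: "K / real z \<ge> 1" using z by simp
  have "(\<Sum>m=1..n. K ^ omega m) \<le> (\<Sum>m=1..n. (K / real z) powr W * real n * (real (z ^ omega m) / real m))"
  proof (rule sum_mono)
    fix m assume m: "m \<in> {1..n}"
    have "K ^ omega m = (K / real z) ^ omega m * real (z ^ omega m)"
      using z by (simp add: power_divide)
    also have "(K / real z) ^ omega m = (K / real z) powr real (omega m)"
      using Kz by (subst powr_realpow) auto
    also have "\<dots> \<le> (K / real z) powr W" using Kz W[OF m] by (intro powr_mono) auto
    finally have "K ^ omega m \<le> (K / real z) powr W * real (z ^ omega m)"
      by (simp add: mult_right_mono)
    also have "\<dots> \<le> (K / real z) powr W * (real n * (real (z ^ omega m) / real m))"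
    proof (rule mult_left_mono)
      have "real (z ^ omega m) * real m \<le> real (z ^ omega m) * real n"
        using m by (intro mult_left_mono) auto
      then show "real (z ^ omega m) \<le> real n * (real (z ^ omega m) / real m)"
        using m by (simp add: field_simps)
    qed simp
    finally show "K ^ omega m \<le> (K / real z) powr W * real n * (real (z ^ omega m) / real m)"
      by (simp add: mult.assoc)
  qed
  also have "\<dots> = (K / real z) powr W * real n * (\<Sum>m=1..n. real (z ^ omega m) / real m)"
    by (simp add: sum_distrib_left)
  also have "\<dots> \<le> (K / real z) powr W * real n * (1 + ln (real n)) ^ z"
  proof (rule mult_left_mono)
    have "(\<Sum>j=1..n. 1 / real j) ^ z \<le> (1 + ln (real n)) ^ z"
      using harmonic_sum_le[OF n] by (intro power_mono sum_nonneg) auto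
    with sum_power_omega_div_le[where n = n and z = z] 
    show "(\<Sum>m=1..n. real (z ^ omega m) / real m) \<le> (1 + ln (real n)) ^ z" by (rule order_trans)
  qed simp
  finally show ?thesis .
qed

section \<open>The size of the least common multiple\<close>

text \<open>
  In the application, \<open>\<mu> m\<close> is the multiplicity of \<open>\<Phi>\<^sub>m\<close> in the mask polynomial and \<open>x = diam A + 1\<close>.
\<close>

context
  fixes \<mu> :: "nat \<Rightarrow> nat" and D :: "nat set" and x c :: real
  assumes x: "x \<ge> 2" and c: "c \<ge> 1"
    and H1: "\<And>m S e. m > 0 \<Longrightarrow> finite S \<Longrightarrow> (\<And>p. p \<in> S \<Longrightarrow> prime p \<and> \<not> p dvd m \<and> e p > 0) \<Longrightarrow>
      real (\<Prod>p\<in>S. p ^ \<mu> (m * p ^ e p)) \<le> x powr (c + real (\<mu> m))"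
    and H2: "\<mu> 1 = 0"
    and fin: "finite D"
    and H3: "\<And>d. d \<in> D \<Longrightarrow> d > 0 \<and> \<mu> d > 0"
    and H4: "real (\<Sum>d\<in>D. totient d) \<le> x"
begin

text \<open>The quotient comes from the norm inequality with every prime estimated below by 2; the
  summand 1 absorbs the additive \<open>c\<close> when a prime factor is added in
  \<open>multiplicity_bound\<close>.\<close>

definition K :: real where "K = 1 + ln x / ln 2"

lemma sum_multiplicities_le:
  assumes "m > 0" "finite S" "\<And>p. p \<in> S \<Longrightarrow> prime p \<and> \<not> p dvd m \<and> e p > 0"
  shows "(\<Sum>p\<in>S. real (\<mu> (m * p ^ e p))) \<le> (c + real (\<mu> m)) * (ln x / ln 2)"
proof -
  let ?j = "\<lambda>p. \<mu> (m * p ^ e p)"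
  have pos: "0 < real (\<Prod>p\<in>S. p ^ ?j p)"
    unfolding of_nat_0_less_iff by (rule prod_pos) (use assms(3) prime_gt_0_nat in auto)
  have "2 ^ (\<Sum>p\<in>S. ?j p) = (\<Prod>p\<in>S. 2 ^ ?j p :: nat)" by (simp add: power_sum)
  also have "\<dots> \<le> (\<Prod>p\<in>S. p ^ ?j p)"
    using assms(3) by (intro prod_mono) (auto intro!: power_mono prime_ge_2_nat)
  finally have "real (2 ^ (\<Sum>p\<in>S. ?j p)) \<le> real (\<Prod>p\<in>S. p ^ ?j p)" by (simp only: of_nat_le_iff)
  also have "\<dots> \<le> x powr (c + real (\<mu> m))" by (rule H1) (use assms in auto)
  finally have "ln (real (2 ^ (\<Sum>p\<in>S. ?j p))) \<le> ln (x powr (c + real (\<mu> m)))"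
    using x by (subst ln_le_cancel_iff) auto
  then have "real (\<Sum>p\<in>S. ?j p) * ln 2 \<le> (c + real (\<mu> m)) * ln x"
    using x by (simp add: ln_realpow ln_powr)
  then show ?thesis by (simp add: pos_le_divide_eq)
qed

lemma K_ge_1: "K \<ge> 1"
  using x by (simp add: K_def)

lemma multiplicity_bound:
  assumes "m > 0"
  shows "c + real (\<mu> m) \<le> c * K ^ omega m"
  using assms
proof (induction m rule: prime_power_mult_induct)
  case one
  then show ?case using H2 by simp
next
  case (step m p a)
  have "(\<Sum>q\<in>{p}. real (\<mu> (m * q ^ a))) \<le> (c + real (\<mu> m)) * (ln x / ln 2)"
    by (rule sum_multiplicities_le) (use step in auto)
  then have "c + real (\<mu> (m * p ^ a)) \<le> c + (c + real (\<mu> m)) * (ln x / ln 2)" by simp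
  also have "\<dots> \<le> (c + real (\<mu> m)) * K" by (simp add: K_def distrib_left)
  also have "\<dots> \<le> c * K ^ omega m * K" using step K_ge_1 by (intro mult_right_mono) auto
  also have "\<dots> = c * K ^ omega (m * p ^ a)"
    using prime_factors_mult_prime_power(3)[of m p a] step by simp
  finally show ?case .
qed

text \<open>Each prime counted contributes a multiplicity of at least 1, since
  \<open>m * p ^ e p\<close> lies in \<open>D\<close>.\<close>

lemma card_primes_small:
  assumes "m > 0" "finite S" "\<And>p. p \<in> S \<Longrightarrow> prime p \<and> \<not> p dvd m \<and> e p > 0 \<and> m * p ^ e p \<in> D"
  shows "real (card S) \<le> c * K ^ omega m * K"
proof -
  have "real (card S) = (\<Sum>p\<in>S. 1)" by simp
  also have "\<dots> \<le> (\<Sum>p\<in>S. real (\<mu> (m * p ^ e p)))"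
    using assms(3) H3 by (intro sum_mono) (auto simp: Suc_le_eq)
  also have "\<dots> \<le> (c + real (\<mu> m)) * (ln x / ln 2)"
    by (rule sum_multiplicities_le) (use assms in auto)
  also have "\<dots> \<le> (c * K ^ omega m) * K"
    using multiplicity_bound[OF assms(1)] x c K_ge_1 by (intro mult_mono) (auto simp: K_def)
  finally show ?thesis .
qed

text \<open>A common bound for \<open>1 + omega d\<close> with \<open>d\<close> in \<open>D\<close>,
  obtained from \<open>le_totient_square\<close> and \<open>totient d \<le> x\<close>.\<close>

definition \<Lambda> :: real where "\<Lambda> = 1 + ln (16 * x\<^sup>2) / ln 2"

lemma totient_le_x: "d \<in> D \<Longrightarrow> real (totient d) \<le> x"
  using H4 member_le_sum[of d D totient] fin of_nat_le_iff[of "totient d" "\<Sum>d\<in>D. totient d"]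
  by (auto intro: order_trans)

lemma omega_le_\<Lambda>:
  assumes "d \<in> D"
  shows "1 + real (omega d) \<le> \<Lambda>"
proof -
  have d: "d > 0" using H3 assms by blast
  have "real (totient d) ^ 2 \<le> x ^ 2" using totient_le_x[OF assms] by (intro power_mono) auto
  then have "real d \<le> 16 * x\<^sup>2" using le_totient_square[OF d] by simp
  then have "ln (real d) \<le> ln (16 * x\<^sup>2)" using d x by (subst ln_le_cancel_iff) auto
  then have "ln (real d) / ln 2 \<le> ln (16 * x\<^sup>2) / ln 2" by (intro divide_right_mono) auto
  then show ?thesis using omega_le_log2[OF d] by (simp add: \<Lambda>_def)
qed

text \<open>Distinct positive integers have a sum of quadratic size, so it suffices to bound the sum
  of the \<open>M * p\<close>. Each is at most \<open>totient (d p) * \<Lambda>\<close>, and a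
  single \<open>d\<close> serves at most \<open>\<Lambda>\<close> primes, so the sum of the totients
  enters at most \<open>\<Lambda>\<close> times.\<close>

lemma card_primes_large:
  fixes S :: "nat set" and d :: "nat \<Rightarrow> nat"
  assumes S: "finite S" and M: "M > 0" 
    and d: "\<And>p. p \<in> S \<Longrightarrow> d p \<in> D \<and> p \<in> prime_factors (d p) \<and> M * real p \<le> real (d p)"
  shows "real (card S) ^ 2 * M \<le> 2 * \<Lambda>\<^sup>2 * x"
proof (cases "S = {}")
  case False
  then obtain p0 where "p0 \<in> S" by blast
  then have \<Lambda>: "\<Lambda> \<ge> 1" using omega_le_\<Lambda> d by fastforce
  have "0 \<notin> S" using d prime_gt_0_nat by fastforce
  then have "real (card S ^ 2) \<le> real (2 * \<Sum>S)" by (intro of_nat_mono card_square_le_sum[OF S])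
  then have "real (card S ^ 2) * M \<le> real (2 * \<Sum>S) * M" using M by (intro mult_right_mono) auto
  then have "real (card S) ^ 2 * M \<le> 2 * (\<Sum>p\<in>S. M * real p)"
    by (simp add: sum_distrib_left mult_ac)
  also have "(\<Sum>p\<in>S. M * real p) \<le> (\<Sum>p\<in>S. real (totient (d p)) * \<Lambda>)"
  proof (rule sum_mono)
    fix p assume p: "p \<in> S"
    then have "M * real p \<le> real (d p)" using d by blast
    also have "\<dots> \<le> real (totient (d p)) * (1 + real (omega (d p)))"
      using d[OF p] H3 by (intro le_totient_mult) auto
    also have "\<dots> \<le> real (totient (d p)) * \<Lambda>"
      using d[OF p] by (intro mult_left_mono omega_le_\<Lambda>) auto
    finally show "M * real p \<le> real (totient (d p)) * \<Lambda>" .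
  qed
  also have "\<dots> = (\<Sum>y\<in>D. \<Sum>p\<in>{p \<in> S. d p = y}. real (totient (d p)) * \<Lambda>)"
    by (rule sum.group[symmetric]) (use S fin d in auto)
  also have "\<dots> \<le> (\<Sum>y\<in>D. \<Lambda> * (real (totient y) * \<Lambda>))"
  proof (rule sum_mono)
    fix y assume y: "y \<in> D"
    have "card {p \<in> S. d p = y} \<le> omega y" by (rule card_mono) (use d in auto)
    then have "real (card {p \<in> S. d p = y}) \<le> \<Lambda>" using omega_le_\<Lambda>[OF y] by linarith
    then have "real (card {p \<in> S. d p = y}) * (real (totient y) * \<Lambda>) \<le> \<Lambda> * (real (totient y) * \<Lambda>)"
      using \<Lambda> by (intro mult_right_mono) auto
    then show "(\<Sum>p\<in>{p \<in> S. d p = y}. real (totient (d p)) * \<Lambda>) \<le> \<Lambda> * (real (totient y) * \<Lambda>)" by simp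
  qed
  also have "\<dots> = \<Lambda>\<^sup>2 * real (\<Sum>y\<in>D. totient y)"
    by (simp add: sum_distrib_left power2_eq_square mult_ac)
  also have "\<dots> \<le> \<Lambda>\<^sup>2 * x" by (intro mult_left_mono H4) auto
  finally show ?thesis by simp
qed (use x in simp)

text \<open>The totient of the prime power divides \<open>totient d\<close> and is at least half of
  the prime power.\<close>

lemma prime_power_le:
  assumes "d \<in> D" "p \<in> prime_factors d"
  shows "real (p ^ multiplicity p d) \<le> 2 * x"
proof -
  have p: "prime p" "p dvd d" using assms(2) by auto
  have d: "d > 0" using H3 assms(1) by blast
  have "multiplicity p d > 0" using assms(2) by (simp add: prime_factors_multiplicity)
  then obtain b where b: "multiplicity p d = Suc b" using gr0_implies_Suc by blast
  have "p ^ Suc b dvd d" using b multiplicity_dvd[of p d] by simp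
  then have "totient (p ^ Suc b) dvd totient d" by (rule totient_dvd)
  then have "p ^ b * (p - 1) \<le> totient d"
    using totient_prime_power_Suc[OF p(1)] d by (auto dest: dvd_imp_le simp del: power_Suc)
  moreover have "p ^ Suc b \<le> 2 * (p ^ b * (p - 1))"
    using prime_ge_2_nat[OF p(1)] by (cases p) (auto simp: algebra_simps)
  ultimately have "p ^ Suc b \<le> 2 * totient d" by linarith
  then have "real (p ^ Suc b) \<le> real (2 * totient d)" by (simp only: of_nat_le_iff)
  then show ?thesis using totient_le_x[OF assms(1)] b by simp
qed

text \<open>A prime enters the least common multiple with its largest exponent, which some element
  of \<open>D\<close> attains, so \<open>prime_power_le\<close> bounds its contribution.\<close>

lemma ln_Lcm_le_card:
  "ln (real (Lcm D)) \<le> real (card (\<Union>d\<in>D. prime_factors d)) * ln (2 * x)"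
proof -
  let ?P = "\<Union>d\<in>D. prime_factors d"
  have finP: "finite ?P" using fin by simp
  define v where "v = (\<lambda>p. Max ((\<lambda>d. multiplicity p d) ` D))"
  have v: "\<exists>d\<in>D. p \<in> prime_factors d \<and> v p = multiplicity p d" if p: "p \<in> ?P" for p
  proof -
    obtain d0 where d0: "d0 \<in> D" "p \<in> prime_factors d0" using p by blast
    have "v p \<in> (\<lambda>d. multiplicity p d) ` D"
      unfolding v_def using fin d0 by (intro Max_in) auto
    then obtain d where d: "d \<in> D" "v p = multiplicity p d" by blast
    have "multiplicity p d0 \<le> v p" unfolding v_def using fin d0 by (intro Max_ge) auto
    then have "p \<in> prime_factors d" using d d0 by (auto simp: prime_factors_multiplicity)
    with d show ?thesis by blast
  qed
  have "Lcm D dvd (\<Prod>p\<in>?P. p ^ v p)"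
  proof (rule Lcm_least)
    fix d assume d: "d \<in> D"
    then have "d = (\<Prod>p\<in>prime_factors d. p ^ multiplicity p d)" 
      using H3 by (intro prime_factorization_nat) auto
    also have "\<dots> dvd (\<Prod>p\<in>prime_factors d. p ^ v p)"
      unfolding v_def using fin d by (intro prod_dvd_prod le_imp_power_dvd Max_ge) auto
    also have "\<dots> dvd (\<Prod>p\<in>?P. p ^ v p)" using finP d by (intro prod_dvd_prod_subset) auto
    finally show "d dvd (\<Prod>p\<in>?P. p ^ v p)" .
  qed
  moreover have "(\<Prod>p\<in>?P. p ^ v p) > 0" 
    by (rule prod_pos) (auto dest: in_prime_factors_imp_prime prime_gt_0_nat)
  ultimately have "Lcm D \<le> (\<Prod>p\<in>?P. p ^ v p)" by (rule dvd_imp_le)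
  then have "real (Lcm D) \<le> (\<Prod>p\<in>?P. real (p ^ v p))" by (simp only: of_nat_le_iff flip: of_nat_prod)
  also have "\<dots> \<le> (\<Prod>p\<in>?P. 2 * x)"
  proof (rule prod_mono)
    fix p assume "p \<in> ?P"
    then obtain d where "d \<in> D" "p \<in> prime_factors d" "v p = multiplicity p d" using v by blast
    then show "0 \<le> real (p ^ v p) \<and> real (p ^ v p) \<le> 2 * x" using prime_power_le by simp
  qed
  finally have le: "real (Lcm D) \<le> (2 * x) ^ card ?P" by simp
  have "Lcm D \<noteq> 0" using fin H3 by (auto simp: Lcm_0_iff)
  then have "ln (real (Lcm D)) \<le> ln ((2 * x) ^ card ?P)" using le x by (subst ln_le_cancel_iff) auto
  also have "\<dots> = real (card ?P) * ln (2 * x)" using x by (intro ln_realpow)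
  finally show ?thesis .
qed

lemma card_primes_le:
  fixes M :: real
  assumes M: "M \<ge> 1"
  shows "real (card (\<Union>d\<in>D. prime_factors d)) \<le>
    c * K * (\<Sum>m=1..nat \<lfloor>M\<rfloor>. K ^ omega m) + 2 * \<Lambda> * sqrt (x / M)"
proof -
  let ?P = "\<Union>d\<in>D. prime_factors d"
  have finP: "finite ?P" using fin by simp
  \<comment> \<open>Any element of \<open>D\<close> divisible by \<open>p\<close> serves here; the
    primes are then split according to its part \<open>m p\<close> prime to
    \<open>p\<close>.\<close>
  have "\<forall>p\<in>?P. \<exists>d\<in>D. p \<in> prime_factors d" by blast
  then obtain d where d: "\<And>p. p \<in> ?P \<Longrightarrow> d p \<in> D \<and> p \<in> prime_factors (d p)" by metis
  define e where "e = (\<lambda>p. multiplicity p (d p))"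
  define m where "m = (\<lambda>p. d p div p ^ e p)"
  have dm: "prime p" "e p > 0" "d p = m p * p ^ e p" "\<not> p dvd m p" "m p > 0" if p: "p \<in> ?P" for p
  proof -
    show pr: "prime p" using d[OF p] by auto
    show "e p > 0" using d[OF p] by (auto simp: e_def prime_factors_multiplicity)
    show eq: "d p = m p * p ^ e p" unfolding m_def e_def by (simp add: multiplicity_dvd)
    have dp: "d p > 0" using d[OF p] H3 by blast
    then show "m p > 0" using eq by (cases "m p") auto
    have "\<not> is_unit p" using pr not_prime_unit by blast
    then show "\<not> p dvd m p" unfolding m_def e_def using dp by (intro multiplicity_decompose) auto
  qed
  define P1 where "P1 = {p \<in> ?P. real (m p) \<le> M}"
  define P2 where "P2 = {p \<in> ?P. real (m p) > M}"
  have fin12: "finite P1" "finite P2" unfolding P1_def P2_def using finP by (intro finite_subset[OF _ finP]; blast)+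
  have "card ?P = card (P1 \<union> P2)" by (rule arg_cong[of _ _ card]) (auto simp: P1_def P2_def)
  also have "\<dots> \<le> card P1 + card P2" by (rule card_Un_le)
  finally have cardP: "real (card ?P) \<le> real (card P1) + real (card P2)" by simp
  let ?n = "nat \<lfloor>M\<rfloor>"
  have "P1 \<subseteq> (\<Union>k\<in>{1..?n}. {p \<in> P1. m p = k})"
  proof
    fix p assume p: "p \<in> P1"
    then have "m p > 0" "real (m p) \<le> M" using dm(5) by (auto simp: P1_def)
    then have "m p \<in> {1..?n}" by (simp add: le_nat_floor Suc_le_eq)
    with p show "p \<in> (\<Union>k\<in>{1..?n}. {p \<in> P1. m p = k})" by blast
  qed
  then have "card P1 \<le> card (\<Union>k\<in>{1..?n}. {p \<in> P1. m p = k})"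
    using fin12 by (intro card_mono) auto
  also have "\<dots> \<le> (\<Sum>k=1..?n. card {p \<in> P1. m p = k})" by (rule card_UN_le) simp
  finally have "real (card P1) \<le> (\<Sum>k=1..?n. real (card {p \<in> P1. m p = k}))"
    by (simp flip: of_nat_sum)
  also have "\<dots> \<le> (\<Sum>k=1..?n. c * K ^ omega k * K)"
  proof (rule sum_mono)
    fix k assume k: "k \<in> {1..?n}"
    show "real (card {p \<in> P1. m p = k}) \<le> c * K ^ omega k * K"
    proof (rule card_primes_small)
      fix p assume "p \<in> {p \<in> P1. m p = k}"
      then have p: "p \<in> ?P" "m p = k" by (auto simp: P1_def)
      show "prime p \<and> \<not> p dvd k \<and> e p > 0 \<and> k * p ^ e p \<in> D"
        using dm[OF p(1)] d[OF p(1)] p(2) by metis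
    qed (use k fin12 in auto)
  qed
  also have "\<dots> = c * K * (\<Sum>m=1..?n. K ^ omega m)" by (simp add: sum_distrib_left mult_ac)
  finally have P1: "real (card P1) \<le> c * K * (\<Sum>m=1..?n. K ^ omega m)" .
  have "real (card P2) ^ 2 * M \<le> 2 * \<Lambda>\<^sup>2 * x"
  proof (rule card_primes_large)
    fix p assume "p \<in> P2"
    then have p: "p \<in> ?P" "real (m p) > M" by (auto simp: P2_def)
    have "p ^ 1 \<le> p ^ e p" using dm(1,2)[OF p(1)] prime_gt_0_nat by (intro power_increasing) (auto simp: Suc_le_eq)
    then have "M * real p \<le> real (m p) * real (p ^ e p)" 
      using p(2) M by (intro mult_mono) (auto simp flip: of_nat_power)
    then have "M * real p \<le> real (d p)" using dm(3)[OF p(1)] by (metis of_nat_mult)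
    then show "d p \<in> D \<and> p \<in> prime_factors (d p) \<and> M * real p \<le> real (d p)"
      using d[OF p(1)] by blast
  qed (use fin12 M in auto)
  then have "real (card P2) ^ 2 \<le> 2 * \<Lambda>\<^sup>2 * (x / M)" using M by (simp add: field_simps)
  \<comment> \<open>Rounding 2 up to 4 makes the bound a perfect square.\<close>
  also have "\<dots> \<le> 4 * \<Lambda>\<^sup>2 * (x / M)" using M x by (intro mult_right_mono) auto
  also have "\<dots> = (2 * \<Lambda> * sqrt (x / M)) ^ 2" using M x by (simp add: power_mult_distrib)
  finally have sq: "real (card P2) ^ 2 \<le> (2 * \<Lambda> * sqrt (x / M)) ^ 2" .
  have "1 \<le> 16 * x\<^sup>2" using x one_le_power[of x 2] by linarith
  then have "\<Lambda> \<ge> 0" unfolding \<Lambda>_def by (simp add: add_nonneg_nonneg)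
  then have "real (card P2) \<le> 2 * \<Lambda> * sqrt (x / M)"
    using M x by (intro power2_le_imp_le[OF sq]) auto
  with P1 cardP show ?thesis by linarith
qed

text \<open>All parameters are expressed by \<open>L\<close>, so that only the asymptotics of an
  explicit real function remain. The assumption \<open>L \<ge> 3\<close> guarantees
  \<open>ln L \<ge> 1\<close>.\<close>

lemma ln_Lcm_le:
  defines "L \<equiv> ln x"
  assumes L: "L \<ge> 3"
  shows "ln (real (Lcm D)) \<le> exp (L / 3) *
    ((c * (1 + L / ln 2) * ((3 * (ln L)\<^sup>2) powr (sqrt L + 2 * L / ln L) * (1 + L) powr (L / (ln L)\<^sup>2 + 1))
      + 2 * (1 + (ln 16 + 2 * L) / ln 2)) * (ln 2 + L))"
proof -
  have x0: "x > 0" using x by simp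
  have lnL: "ln L \<ge> 1"
  proof -
    have "exp 1 \<le> L" using exp_le L by linarith
    then have "ln (exp 1) \<le> ln L" using L by (subst ln_le_cancel_iff) auto
    then show ?thesis by simp
  qed
  \<comment> \<open>This is the cube root of \<open>x\<close>, which balances the two terms of
    \<open>card_primes_le\<close>: \<open>sqrt (x / M) = M\<close>.\<close>
  define M where "M = exp (L / 3)"
  have M: "M \<ge> 1" using L by (simp add: M_def)
  have xM: "sqrt (x / M) = M"
  proof -
    have "x = exp L" using x0 by (simp add: L_def)
    then have "x / M = exp (L - L / 3)" by (simp only: M_def exp_diff)
    also have "L - L / 3 = L / 3 + L / 3" by simp
    also have "exp (L / 3 + L / 3) = M ^ 2" by (simp only: M_def exp_add power2_eq_square)
    finally show ?thesis using M by simp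
  qed
  have Mx: "M \<le> x"
  proof -
    have "M \<le> exp L" using L by (simp add: M_def)
    then show ?thesis using x0 by (simp add: L_def)
  qed
  define n where "n = nat \<lfloor>M\<rfloor>"
  have n: "n > 0" "real n \<le> M" using M by (auto simp: n_def)
  have lnm: "ln (real m) \<le> L" if "m \<in> {1..n}" for m
    unfolding L_def using that n Mx x0 by (subst ln_le_cancel_iff) auto
  \<comment> \<open>A compromise: \<open>z\<close> of order \<open>L\<close> would make
    \<open>(1 + L) ^ z\<close> too large, bounded \<open>z\<close> would do the same to
    \<open>(K / z) powr W\<close>. With this order of \<open>z\<close> both are \<open>exp\<close>
    of something of smaller order than \<open>L\<close>.\<close>
  define a where "a = L / (ln L)\<^sup>2"
  have sq: "(ln L)\<^sup>2 \<ge> 1" using lnL by simp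
  have a: "0 < a" "a \<le> L"
    using L lnL sq divide_left_mono[of 1 "(ln L)\<^sup>2" L] by (auto simp: a_def)
  define z where "z = nat \<lceil>a\<rceil>"
  have z: "z > 0" "a \<le> real z" "real z \<le> a + 1" using a by (auto simp: z_def)
  \<comment> \<open>The lower bound gives \<open>real z \<le> a + 1 \<le> K\<close>, as
    \<open>sum_powr_omega_le\<close> demands.\<close>
  have KL: "L + 1 \<le> K" "K \<le> 3 * L"
  proof -
    have "L * 1 \<le> L * (1 / ln 2)" using L ln_2_less_1 by (intro mult_left_mono) (auto simp: field_simps)
    then show "L + 1 \<le> K" by (simp add: K_def L_def)
    have "L / ln 2 \<le> L / (1 / 2)" using L ln_2_ge_half by (intro divide_left_mono) auto
    then show "K \<le> 3 * L" using L by (simp add: K_def flip: L_def)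
  qed
  \<comment> \<open>This is \<open>omega_le\<close> with cut-off \<open>sqrt L\<close>, whose
    logarithm is still half of \<open>ln L\<close>.\<close>
  define W where "W = sqrt L + 2 * L / ln L"
  have W: "real (omega m) \<le> W" if m: "m \<in> {1..n}" for m
  proof -
    have "real (omega m) \<le> sqrt L + ln (real m) / ln (sqrt L)"
      using m L by (intro omega_le) auto
    also have "ln (sqrt L) = ln L / 2" using L by (simp add: ln_sqrt)
    also have "ln (real m) / (ln L / 2) \<le> L / (ln L / 2)"
      using lnm[OF m] lnL by (intro divide_right_mono) auto
    finally show ?thesis by (simp add: W_def mult.commute)
  qed
  have Kz: "K / real z \<le> 3 * (ln L)\<^sup>2"
  proof -
    have "K / real z \<le> (3 * L) / a" using KL z a L by (intro frac_le) auto
    also have "\<dots> = 3 * (ln L)\<^sup>2" using L by (simp add: a_def)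
    finally show ?thesis .
  qed
  have "(\<Sum>m=1..n. K ^ omega m) \<le> (K / real z) powr W * real n * (1 + ln (real n)) ^ z"
    using n z a KL W by (intro sum_powr_omega_le) auto
  also have "\<dots> \<le> (3 * (ln L)\<^sup>2) powr W * M * (1 + L) powr (a + 1)"
  proof (intro mult_mono)
    show "(K / real z) powr W \<le> (3 * (ln L)\<^sup>2) powr W"
      using Kz K_ge_1 L lnL by (intro powr_mono2) (auto simp: W_def)
    have "(1 + ln (real n)) ^ z \<le> (1 + L) ^ z"
      using lnm[of n] n by (intro power_mono) auto
    also have "\<dots> = (1 + L) powr real z" using L by (simp add: powr_realpow)
    also have "\<dots> \<le> (1 + L) powr (a + 1)" using z L by (intro powr_mono) auto
    finally show "(1 + ln (real n)) ^ z \<le> (1 + L) powr (a + 1)" .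
  qed (use n M in auto)
  finally have S: "(\<Sum>m=1..n. K ^ omega m) \<le> M * ((3 * (ln L)\<^sup>2) powr W * (1 + L) powr (a + 1))"
    by (simp only: mult_ac)
  have "real (card (\<Union>d\<in>D. prime_factors d)) \<le> c * K * (\<Sum>m=1..n. K ^ omega m) + 2 * \<Lambda> * M"
    using card_primes_le[OF M] by (simp add: xM n_def)
  also have "\<dots> \<le> c * K * (M * ((3 * (ln L)\<^sup>2) powr W * (1 + L) powr (a + 1))) + 2 * \<Lambda> * M"
    using c K_ge_1 by (intro add_right_mono mult_left_mono S) auto
  finally have card: "real (card (\<Union>d\<in>D. prime_factors d)) \<le>
      M * (c * K * ((3 * (ln L)\<^sup>2) powr W * (1 + L) powr (a + 1)) + 2 * \<Lambda>)"
    by (simp add: algebra_simps)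
  have ln2x: "ln (2 * x) = ln 2 + L" using x0 by (simp add: ln_mult L_def)
  have \<Lambda>: "\<Lambda> = 1 + (ln 16 + 2 * L) / ln 2" using x0 by (simp add: \<Lambda>_def ln_mult ln_realpow L_def)
  have "ln (real (Lcm D)) \<le> real (card (\<Union>d\<in>D. prime_factors d)) * (ln 2 + L)"
    using ln_Lcm_le_card unfolding ln2x .
  also have "\<dots> \<le> M * (c * K * ((3 * (ln L)\<^sup>2) powr W * (1 + L) powr (a + 1)) + 2 * \<Lambda>) * (ln 2 + L)"
    using card L by (intro mult_right_mono) auto
  finally show ?thesis by (simp only: M_def W_def a_def \<Lambda> K_def L_def mult.assoc)
qed

end

section \<open>Asymptotics and conclusion\<close>

theorem theorem6:
  fixes c :: real
  assumes "c < 100 * ln 2 - 2"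
  shows "\<forall>\<epsilon>::real. \<epsilon> > 0 \<longrightarrow>
    (\<exists>n0::int. \<forall>(t::nat) (A::int multiset) (B::int \<Rightarrow> nat).
       t > 0 \<longrightarrow> A \<noteq> {#} \<longrightarrow> diam A \<ge> n0 \<longrightarrow>
       real (\<Sum>a\<in>set_mset A. count A a) \<le> real_of_int (diam A + 1) powr c \<longrightarrow>
       is_tiling t A B \<longrightarrow>
       (\<exists>k::int. periodic_with B k \<and>
          ln (real_of_int k) \<le> real_of_int (diam A + 1) powr (1 / 3 + \<epsilon>)))"
proof (intro allI impI)
  fix \<epsilon> :: real assume \<epsilon>: "\<epsilon> > 0"
  \<comment> \<open>The estimates above require an exponent of at least 1; enlarging it preserves
    the bound on the total weight.\<close>
  define C where "C = max c 1"
  define F where "F = (\<lambda>L::real. (3 * (ln L)\<^sup>2) powr (sqrt L + 2 * L / ln L) * (1 + L) powr (L / (ln L)\<^sup>2 + 1))"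
  define G where "G = (\<lambda>L::real. (C * (1 + L / ln 2) * F L + 2 * (1 + (ln 16 + 2 * L) / ln 2)) * (ln 2 + L))"
  \<comment> \<open>Half of \<open>\<epsilon>\<close> pays for the subpolynomial factor
    \<open>F\<close>, the other half for the remaining factors, which are polynomial in
    \<open>L\<close>.\<close>
  have "eventually (\<lambda>L. F L \<le> exp (\<epsilon> / 2 * L)) at_top"
    unfolding F_def using \<epsilon> by real_asymp
  moreover have "eventually (\<lambda>L::real. (C * (1 + L / ln 2) * exp (\<epsilon> / 2 * L) +
      2 * (1 + (ln 16 + 2 * L) / ln 2)) * (ln 2 + L) \<le> exp (\<epsilon> * L)) at_top"
    using \<epsilon> by real_asymp
  moreover have "eventually (\<lambda>L::real. L \<ge> 3) at_top" by (rule eventually_ge_at_top)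
  ultimately have "eventually (\<lambda>L. L \<ge> 3 \<and> G L \<le> exp (\<epsilon> * L)) at_top"
  proof eventually_elim
    case (elim L)
    have "G L \<le> (C * (1 + L / ln 2) * exp (\<epsilon> / 2 * L) + 2 * (1 + (ln 16 + 2 * L) / ln 2)) * (ln 2 + L)"
      unfolding G_def using elim
      by (intro mult_right_mono add_right_mono mult_left_mono) (auto simp: C_def)
    with elim show ?case by simp
  qed
  then obtain L0 where L0: "\<And>L. L \<ge> L0 \<Longrightarrow> L \<ge> 3 \<and> G L \<le> exp (\<epsilon> * L)"
    by (auto simp: eventually_at_top_linorder)
  show "\<exists>n0::int. \<forall>(t::nat) (A::int multiset) (B::int \<Rightarrow> nat).
       t > 0 \<longrightarrow> A \<noteq> {#} \<longrightarrow> diam A \<ge> n0 \<longrightarrow>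
       real (\<Sum>a\<in>set_mset A. count A a) \<le> real_of_int (diam A + 1) powr c \<longrightarrow>
       is_tiling t A B \<longrightarrow>
       (\<exists>k::int. periodic_with B k \<and>
          ln (real_of_int k) \<le> real_of_int (diam A + 1) powr (1 / 3 + \<epsilon>))"
  \<comment> \<open>This threshold ensures both \<open>x \<ge> 2\<close> and
    \<open>ln x \<ge> L0\<close>.\<close>
  proof (rule exI[of _ "max 1 \<lceil>exp L0\<rceil>"], intro allI impI)
    fix t :: nat and A :: "int multiset" and B :: "int \<Rightarrow> nat"
    assume A: "A \<noteq> {#}" and diam: "diam A \<ge> max 1 \<lceil>exp L0\<rceil>"
      and sum: "real (\<Sum>a\<in>set_mset A. count A a) \<le> real_of_int (diam A + 1) powr c"
      and tiling: "is_tiling t A B"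
    define x where "x = real_of_int (diam A + 1)"
    have "diam A \<ge> 1" "\<lceil>exp L0\<rceil> \<le> diam A" using diam by linarith+
    then have x: "x \<ge> 2" "exp L0 \<le> x" unfolding x_def by linarith+
    define P where "P = mask_poly A"
    have P0: "P \<noteq> 0" unfolding P_def by (rule mask_poly_ne_0[OF A])
    have deg: "real (degree P) \<le> x"
      using \<open>diam A \<ge> 1\<close> by (simp add: P_def degree_mask_poly[OF A] x_def)
    define \<mu> where "\<mu> = (\<lambda>m. multiplicity (cyc m) P)"
    obtain D where D: "finite D" "\<And>d. d \<in> D \<Longrightarrow> d > 0 \<and> cyc d dvd P" "periodic_with B (int (Lcm D))"
      using tiling_period[OF A tiling] unfolding P_def by blast
    have "poly_l1 P \<le> x powr c"
      using sum by (simp add: P_def poly_l1_mask_poly[OF A] x_def)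
    also have "\<dots> \<le> x powr C" using x by (intro powr_mono) (auto simp: C_def)
    finally have l1: "poly_l1 P \<le> x powr C" .
    have L: "ln x \<ge> L0"
    proof -
      have "ln (exp L0) \<le> ln x" using x by (subst ln_le_cancel_iff) auto
      then show ?thesis by simp
    qed
    have "ln (real (Lcm D)) \<le> exp (ln x / 3) * G (ln x)"
      unfolding G_def F_def
    proof (rule ln_Lcm_le[of x C \<mu> D])
      show "x \<ge> 2" "C \<ge> 1" "finite D" using x D by (auto simp: C_def)
      show "3 \<le> ln x" using L0 L by blast
      show "\<mu> 1 = 0" unfolding \<mu>_def P_def by (rule multiplicity_cyc_1_mask_poly[OF A])
      show "d > 0 \<and> \<mu> d > 0" if "d \<in> D" for d
      proof -
        have "\<not> is_unit (cyc d)" using prime_elem_cyc D(2)[OF that] by (auto simp: prime_elem_def)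
        then show ?thesis using D(2)[OF that] P0 unfolding \<mu>_def by (simp add: multiplicity_gt_zero_iff)
      qed
      show "real (\<Sum>d\<in>D. totient d) \<le> x"
        using sum_totient_le_degree[OF D(1,2) P0] deg by linarith
      fix m S and e :: "nat \<Rightarrow> nat"
      assume "m > 0" "finite S" "\<And>p. p \<in> S \<Longrightarrow> prime p \<and> \<not> p dvd m \<and> e p > 0"
      then have "real (\<Prod>p\<in>S. p ^ \<mu> (m * p ^ e p)) \<le> poly_l1 P * real (degree P) ^ \<mu> m"
        unfolding \<mu>_def by (intro prod_prime_multiplicity_cyc_le P0) auto
      also have "\<dots> \<le> x powr C * x ^ \<mu> m"
        using l1 deg x by (intro mult_mono power_mono) auto
      also have "\<dots> = x powr (C + real (\<mu> m))" using x by (simp add: powr_add powr_realpow)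
      finally show "real (\<Prod>p\<in>S. p ^ \<mu> (m * p ^ e p)) \<le> x powr (C + real (\<mu> m))" .
    qed
    also have "\<dots> \<le> exp (ln x / 3) * exp (\<epsilon> * ln x)" using L0[OF L] by (intro mult_left_mono) auto
    also have "\<dots> = exp ((1 / 3 + \<epsilon>) * ln x)" by (simp add: distrib_right flip: exp_add)
    also have "\<dots> = x powr (1 / 3 + \<epsilon>)" using x by (simp add: powr_def)
    finally have "ln (real_of_int (int (Lcm D))) \<le> x powr (1 / 3 + \<epsilon>)" by simp
    then show "\<exists>k::int. periodic_with B k \<and> 
        ln (real_of_int k) \<le> real_of_int (diam A + 1) powr (1 / 3 + \<epsilon>)"
      using D(3) unfolding x_def by blast
  qed
qed

end
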